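(* There exists a coupling (i.e. a realization on a common probability space) of planar standard Brownian motion $B$ and planar simple random walk $S$, both started at the origin, such that for every function $g:\{1,2,\dots\}\to\mathbb{R}$ with $g(n)\geq 1$ for all $n$ and $g(n) = O(n^{1/4})$, there exist constants $b,K>0$ such that for all integers $n\ge 1$, $$\mathbb{P}\Big\{\sup_{0\leq t \leq n}|B(t) - S(2t)|\geq n^{1/4}g(n)\Big\} \leq Kne^{-bg(n)}.$$
   Context: Planar simple random walk $S$ is defined by $S(0)=(0,0)$ and $S(n)=\sum_{k=1}^n X_k$ for positive integers $n$, where $X_1,X_2,\dots$ are independent with $\mathbb{P}\{X_k=\pm e_i\}=\frac14$, $i=1,2$, $e_1=(1,0)$, $e_2=(0,1)$. It is extended to real times $t\ge 0$ by linear interpolation: $S(t)=S([t])+(t-[t])(S([t]+1)-S([t]))$, with $[t]$ the integer part of $t$. The supremum is over real $t$. $|\cdot|$ is the Euclidean norm. *)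

theory Defs
  imports "HOL-Probability.Probability" "HOL-Library.Landau_Symbols"
begin

text \<open>
  The plane is \<^typ>\<open>real \<times> real\<close>, whose library norm is the Euclidean norm. Processes on the half-line
  take a real time argument; their values at negative times are unconstrained.
\<close>

context prob_space
begin

text \<open>
  Standard planar Brownian motion started at the origin: increments over \<open>[s, t]\<close> are independent
  and have law \<open>N(0, (t - s) I)\<close>. Start and continuity are required for every sample point rather
  than almost surely; this keeps suprema of the path over compact time intervals finite and
  measurable without completing \<open>M\<close>.
\<close>

definition planar_brownian_motion :: "(real \<Rightarrow> 'a \<Rightarrow> real \<times> real) \<Rightarrow> bool" where
  "planar_brownian_motion B \<longleftrightarrow>
     (\<forall>t\<ge>0. random_variable borel (B t)) \<and>
     (\<forall>\<omega>\<in>space M. B 0 \<omega> = (0, 0)) \<and>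
     (\<forall>\<omega>\<in>space M. continuous_on {0..} (\<lambda>t. B t \<omega>)) \<and>
     (\<forall>s t. 0 \<le> s \<and> s < t \<longrightarrow>
        distributed M lborel (\<lambda>\<omega>. B t \<omega> - B s \<omega>)
          (\<lambda>(x, y). ennreal (normal_density 0 (sqrt (t - s)) x * normal_density 0 (sqrt (t - s)) y))) \<and>
     (\<forall>(\<tau> :: nat \<Rightarrow> real) m. 0 \<le> \<tau> 0 \<and> (\<forall>i<m. \<tau> i \<le> \<tau> (Suc i)) \<longrightarrow>
        indep_vars (\<lambda>_. borel) (\<lambda>i \<omega>. B (\<tau> (Suc i)) \<omega> - B (\<tau> i) \<omega>) {..<m})"

definition planar_simple_random_walk :: "(nat \<Rightarrow> 'a \<Rightarrow> real \<times> real) \<Rightarrow> bool" where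
  "planar_simple_random_walk S \<longleftrightarrow>
     (\<exists>X :: nat \<Rightarrow> 'a \<Rightarrow> real \<times> real.
        indep_vars (\<lambda>_. borel) X {1..} \<and>
        (\<forall>k\<ge>1. \<forall>v\<in>{(1, 0), (-1, 0), (0, 1), (0, -1)}. prob {\<omega> \<in> space M. X k \<omega> = v} = 1 / 4) \<and>
        (\<forall>n. \<forall>\<omega>\<in>space M. S n \<omega> = (\<Sum>k=1..n. X k \<omega>)))"

end

text \<open>Extension of a sequence to real times \<open>t \<ge> 0\<close>; the value at negative times is irrelevant.\<close>

definition linear_interpolation :: "(nat \<Rightarrow> 'v::real_vector) \<Rightarrow> real \<Rightarrow> 'v" where
  "linear_interpolation s t =
     s (nat \<lfloor>t\<rfloor>) + (t - of_int \<lfloor>t\<rfloor>) *\<^sub>R (s (nat \<lfloor>t\<rfloor> + 1) - s (nat \<lfloor>t\<rfloor>))"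

end

theory Submission
  imports Defs "HOL-Real_Asymp.Real_Asymp"
begin

text \<open>
  In the coordinates \<open>x + y\<close> and \<open>x - y\<close> a planar simple random walk is a pair of independent
  one-dimensional ones. A one-dimensional walk \<open>S\<^sub>0\<close> is refined to walks \<open>S\<^sub>1, S\<^sub>2, \<dots>\<close> with
  \<open>S\<^sub>m\<^sub>+\<^sub>1(2 i) = 2 S\<^sub>m(N\<^sub>i)\<close>, where \<open>N\<^sub>i\<close> is binomial with mean \<open>i / 2\<close> and independent of \<open>S\<^sub>m\<close>; this
  is Skorokhod embedding of \<open>S\<^sub>m\<close> in \<open>S\<^sub>m\<^sub>+\<^sub>1\<close>. Since \<open>N\<^sub>i - i / 2\<close> is subgaussian of order \<open>\<surd>i\<close>, the
  displacement \<open>S\<^sub>m(N\<^sub>i) - S\<^sub>m(i / 2)\<close> has exponential moments at scale \<open>i\<^bsup>1/4\<^esup>\<close>. A union bound over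
  \<open>i\<close> and \<open>m\<close> shows that \<open>2\<^bsup>-m\<^esup> S\<^sub>m(4\<^bsup>m\<^esup> t)\<close> converges locally uniformly, at distance of order
  \<open>n\<^bsup>1/4\<^esup> g\<close> from \<open>S\<^sub>0\<close> on \<open>[0, n]\<close> outside an event of probability \<open>O(n e\<^bsup>-bg\<^esup>)\<close>. The limit is
  Brownian motion because independence and characteristic functions of increments pass to the limit.
\<close>

subsection \<open>Independent fair signs\<close>

context prob_space
begin

text \<open>Refining upwards builds Brownian motion together with the walk, from countably many
  coins. The form of the refinement is forced: a fair walk watched at even times pauses with
  probability 1/2 and otherwise moves by 2, so one coarse step takes four fine ones on average,
  which is Brownian scaling with ratio 2 in space and 4 in time. Run backwards, this lets pauses and
  coarse moves be chosen independently, whence the independence of \<open>N_i\<close> and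
  \<open>S_m\<close>. The obstacle is that fine steps read coarse steps at random indices, yet must
  again be independent fair signs. Once a finite pattern of fine steps is prescribed, however, all
  indices become deterministic, and the pattern prescribes equally many distinct coins; fairness is
  therefore handled throughout by pattern probabilities. A displacement over about
  \<open>sqrt i\<close> random steps has variance of order \<open>sqrt i\<close>, so its exponential
  moment at parameter \<open>t\<close> stays bounded for \<open>t\<close> up to order
  \<open>i powr (- 1 / 4)\<close>. This gives the factor \<open>n powr (1 / 4)\<close>, and a tail
  exponential in \<open>g\<close>.\<close>

definition fair_signs :: "'i set \<Rightarrow> ('i \<Rightarrow> 'a \<Rightarrow> real) \<Rightarrow> bool" where
  "fair_signs I X \<longleftrightarrow> indep_vars (\<lambda>_. borel) X I \<and>
     (\<forall>i\<in>I. \<forall>\<omega>\<in>space M. X i \<omega> \<in> {-1, 1}) \<and>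
     (\<forall>i\<in>I. prob {\<omega> \<in> space M. X i \<omega> = 1} = 1 / 2)"

lemma fair_signs_rv: "fair_signs I X \<Longrightarrow> i \<in> I \<Longrightarrow> X i \<in> borel_measurable M"
  by (auto simp: fair_signs_def indep_vars_def2)

lemma fair_signs_values: "fair_signs I X \<Longrightarrow> i \<in> I \<Longrightarrow> \<omega> \<in> space M \<Longrightarrow> X i \<omega> \<in> {-1, 1}"
  by (simp add: fair_signs_def)

lemma fair_signs_subset: "fair_signs I X \<Longrightarrow> J \<subseteq> I \<Longrightarrow> fair_signs J X"
  by (auto simp: fair_signs_def intro: indep_vars_subset)

lemma fair_signs_prob:
  assumes X: "fair_signs I X" and i: "i \<in> I" and s: "s \<in> {-1, 1}"
  shows "prob {\<omega> \<in> space M. X i \<omega> = s} = 1 / 2"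
proof (cases "s = 1")
  case True
  then show ?thesis using X i by (simp add: fair_signs_def)
next
  case False
  then have s: "s = -1" using s by auto
  have [measurable]: "X i \<in> borel_measurable M" by (rule fair_signs_rv[OF X i])
  have "{\<omega> \<in> space M. X i \<omega> = s} = space M - {\<omega> \<in> space M. X i \<omega> = 1}"
    using fair_signs_values[OF X i] s by force
  also have "prob \<dots> = 1 - 1 / 2"
    using X i by (subst prob_compl) (auto simp: fair_signs_def)
  finally show ?thesis by simp
qed

lemma fair_signs_pattern:
  assumes X: "fair_signs I X" and J: "finite J" "J \<subseteq> I" and a: "\<And>i. i \<in> J \<Longrightarrow> a i \<in> {-1, 1}"
  shows "prob {\<omega> \<in> space M. \<forall>i\<in>J. X i \<omega> = a i} = (1 / 2) ^ card J"
proof (cases "J = {}")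
  case True
  then show ?thesis by (simp add: prob_space)
next
  case False
  have "{\<omega> \<in> space M. \<forall>i\<in>J. X i \<omega> = a i} = (\<Inter>i\<in>J. X i -` {a i} \<inter> space M)"
    using False by auto
  also have "prob \<dots> = (\<Prod>i\<in>J. prob (X i -` {a i} \<inter> space M))"
    using X J False by (intro indep_varsD) (auto simp: fair_signs_def)
  also have "\<dots> = (\<Prod>i\<in>J. 1 / 2)"
  proof (rule prod.cong)
    fix i assume i: "i \<in> J"
    have "X i -` {a i} \<inter> space M = {\<omega> \<in> space M. X i \<omega> = a i}" by auto
    then show "prob (X i -` {a i} \<inter> space M) = 1 / 2"
      using fair_signs_prob[OF X _ a[OF i]] i J by auto
  qed simp
  finally show ?thesis by simp
qed

text \<open>A pattern on \<open>J'\<close> determines the patterns on its subsets by summation, so a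
  cofinal family of finite sets suffices. This freedom matters because refined steps have a simple
  joint law only on complete pairs counted from the start.\<close>

lemma fair_signsI:
  fixes X :: "'i \<Rightarrow> 'a \<Rightarrow> real"
  assumes rv [measurable]: "\<And>i. i \<in> I \<Longrightarrow> X i \<in> borel_measurable M"
    and signs: "\<And>i \<omega>. i \<in> I \<Longrightarrow> \<omega> \<in> space M \<Longrightarrow> X i \<omega> \<in> {-1, 1}"
    and cofinal: "\<And>J. finite J \<Longrightarrow> J \<subseteq> I \<Longrightarrow> \<exists>J'. finite J' \<and> J \<subseteq> J' \<and> J' \<subseteq> I \<and>
      (\<forall>a. (\<forall>i\<in>J'. a i \<in> {-1, 1}) \<longrightarrow>
        prob {\<omega> \<in> space M. \<forall>i\<in>J'. X i \<omega> = a i} = (1 / 2) ^ card J')"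
  shows "fair_signs I X"
proof -
  have prob_INT: "prob {\<omega> \<in> space M. \<forall>i\<in>J. X i \<omega> \<in> B i} = (\<Prod>i\<in>J. real (card (B i \<inter> {-1, 1})) / 2)"
    if J: "finite J" "J \<subseteq> I" and B: "\<And>i. i \<in> J \<Longrightarrow> B i \<in> sets borel" for J and B :: "'i \<Rightarrow> real set"
  proof -
    obtain J' where J': "finite J'" "J \<subseteq> J'" "J' \<subseteq> I"
      and pat: "\<And>a. (\<forall>i\<in>J'. a i \<in> {-1, 1}) \<Longrightarrow>
        prob {\<omega> \<in> space M. \<forall>i\<in>J'. X i \<omega> = a i} = (1 / 2) ^ card J'"
      using cofinal[OF J] by blast
    \<comment> \<open>Coordinates in \<open>J' - J\<close> are left free: there \<open>C i\<close>
      has two elements and contributes a factor 1 to the product.\<close>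
    define C where "C i = (if i \<in> J then B i else UNIV) \<inter> {-1, 1 :: real}" for i
    define E where "E a = {\<omega> \<in> space M. \<forall>i\<in>J'. X i \<omega> = a i}" for a
    have finC: "finite (PiE J' C)" by (intro finite_PiE J') (auto simp: C_def)
    have "{\<omega> \<in> space M. \<forall>i\<in>J. X i \<omega> \<in> B i} = (\<Union>a\<in>PiE J' C. E a)"
    proof (intro equalityI subsetI)
      fix \<omega> assume w: "\<omega> \<in> {\<omega> \<in> space M. \<forall>i\<in>J. X i \<omega> \<in> B i}"
      then have "restrict (\<lambda>i. X i \<omega>) J' \<in> PiE J' C"
        using J' signs by (fastforce simp: C_def)
      moreover have "\<omega> \<in> E (restrict (\<lambda>i. X i \<omega>) J')" using w by (simp add: E_def)
      ultimately show "\<omega> \<in> (\<Union>a\<in>PiE J' C. E a)" by blast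
    next
      fix \<omega> assume "\<omega> \<in> (\<Union>a\<in>PiE J' C. E a)"
      then obtain a where "a \<in> PiE J' C" "\<omega> \<in> E a" by blast
      then show "\<omega> \<in> {\<omega> \<in> space M. \<forall>i\<in>J. X i \<omega> \<in> B i}"
        using J' by (auto simp: E_def C_def PiE_iff split: if_splits dest!: bspec)
    qed
    also have "prob \<dots> = (\<Sum>a\<in>PiE J' C. prob (E a))"
    proof (rule finite_measure_finite_Union[OF finC])
      show "E ` PiE J' C \<subseteq> events"
      proof safe
        fix a
        show "E a \<in> events"
          unfolding E_def
        proof (rule sets.sets_Collect_finite_All[OF _ J'(1)])
          fix i assume "i \<in> J'"
          then have [measurable]: "X i \<in> borel_measurable M" using J' rv by blast
          show "{\<omega> \<in> space M. X i \<omega> = a i} \<in> events" by measurable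
        qed
      qed
      show "disjoint_family_on E (PiE J' C)"
        unfolding disjoint_family_on_def E_def
        by (auto simp: fun_eq_iff PiE_iff extensional_def) metis
    qed
    also have "\<dots> = (\<Sum>a\<in>PiE J' C. (1 / 2) ^ card J')"
    proof (rule sum.cong)
      fix a assume "a \<in> PiE J' C"
      then have "\<forall>i\<in>J'. a i \<in> {-1, 1}" by (auto simp: C_def PiE_iff)
      then show "prob (E a) = (1 / 2) ^ card J'" unfolding E_def by (rule pat)
    qed simp
    also have "\<dots> = (\<Prod>i\<in>J'. real (card (C i)) / 2)"
      by (simp add: card_PiE[OF J'(1)] prod_dividef power_one_over)
    also have "\<dots> = (\<Prod>i\<in>J. real (card (C i)) / 2)"
      by (rule prod.mono_neutral_right) (use J' in \<open>auto simp: C_def\<close>)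
    finally show ?thesis by (simp add: C_def)
  qed
  have single: "prob {\<omega> \<in> space M. X i \<omega> \<in> B} = real (card (B \<inter> {-1, 1})) / 2"
    if "i \<in> I" "B \<in> sets borel" for i B
    using prob_INT[of "{i}" "\<lambda>_. B"] that by simp
  show ?thesis
    unfolding fair_signs_def indep_vars_def2
  proof (intro conjI ballI indep_setsI)
    fix A J assume J: "J \<noteq> {}" "J \<subseteq> I" "finite J"
      and A: "\<forall>j\<in>J. A j \<in> {X j -` A \<inter> space M |A. A \<in> sets borel}"
    then obtain B where B: "\<And>j. j \<in> J \<Longrightarrow> A j = X j -` B j \<inter> space M"
      "\<And>j. j \<in> J \<Longrightarrow> B j \<in> sets borel"
      by simp metis
    have A': "A j = {\<omega> \<in> space M. X j \<omega> \<in> B j}" if "j \<in> J" for j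
      using B(1)[OF that] by auto
    have "(\<Inter>j\<in>J. A j) = {\<omega> \<in> space M. \<forall>i\<in>J. X i \<omega> \<in> B i}"
      using J(1) A' by auto
    then have "prob (\<Inter>j\<in>J. A j) = (\<Prod>i\<in>J. real (card (B i \<inter> {-1, 1})) / 2)"
      using prob_INT[OF J(3,2) B(2)] by simp
    also have "\<dots> = (\<Prod>j\<in>J. prob (A j))"
      using J by (intro prod.cong) (auto simp: A' single B)
    finally show "prob (\<Inter>j\<in>J. A j) = (\<Prod>j\<in>J. prob (A j))" .
  next
    fix i assume "i \<in> I"
    then show "prob {\<omega> \<in> space M. X i \<omega> = 1} = 1 / 2"
      using single[of i "{1}"] by simp
  qed (use rv signs in auto)
qed

end

subsection \<open>Refining a walk\<close>

definition walk :: "(nat \<Rightarrow> real) \<Rightarrow> nat \<Rightarrow> real" where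
  "walk x n = (\<Sum>k<n. x k)"

definition moves :: "(nat \<Rightarrow> real) \<Rightarrow> nat \<Rightarrow> nat" where
  "moves e i = card {j. j < i \<and> e (2 * j) = 1}"

text \<open>
  Fine steps come in pairs. Coin \<open>e (2 * i)\<close> is the flag of pair \<open>i\<close>: if it is \<open>1\<close>, both steps of the
  pair equal the next unused coarse step; otherwise the pair is a loop starting with \<open>e (2 * i + 1)\<close>.
\<close>

definition refine :: "(nat \<Rightarrow> real) \<Rightarrow> (nat \<Rightarrow> real) \<Rightarrow> nat \<Rightarrow> real" where
  "refine x e k =
     (if e (2 * (k div 2)) = 1 then x (moves e (k div 2))
      else if even k then e (Suc k) else - e k)"

text \<open>Level \<open>m\<close> spends only coins of levels up to \<open>m\<close>, so all coins
  of higher levels stay fresh for later refinements.\<close>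

fun steps :: "(nat \<Rightarrow> nat \<Rightarrow> real) \<Rightarrow> nat \<Rightarrow> nat \<Rightarrow> real" where
  "steps e 0 = e 0"
| "steps e (Suc m) = refine (steps e m) (e (Suc m))"

lemma moves_0 [simp]: "moves e 0 = 0"
  by (simp add: moves_def)

lemma moves_Suc: "moves e (Suc i) = moves e i + (if e (2 * i) = 1 then 1 else 0)"
proof -
  have "{j. j < Suc i \<and> e (2 * j) = 1} =
      (if e (2 * i) = 1 then insert i else id) {j. j < i \<and> e (2 * j) = 1}"
    by (auto simp: less_Suc_eq)
  then show ?thesis by (simp add: moves_def)
qed

lemma moves_mono: "i \<le> j \<Longrightarrow> moves e i \<le> moves e j"
  by (auto simp: moves_def intro!: card_mono)

lemma moves_le: "moves e i \<le> i"
  by (induction i) (auto simp: moves_Suc)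

lemma moves_cong: "(\<And>j. j < i \<Longrightarrow> e (2 * j) = e' (2 * j)) \<Longrightarrow> moves e i = moves e' i"
  unfolding moves_def by (rule arg_cong[of _ _ card]) auto

lemma measurable_moves [measurable]:
  assumes [measurable]: "\<And>k. (\<lambda>\<omega>. e \<omega> k) \<in> borel_measurable N"
  shows "(\<lambda>\<omega>. moves (e \<omega>) i) \<in> measurable N (count_space UNIV)"
proof (induction i)
  case (Suc i)
  note [measurable] = Suc
  show ?case unfolding moves_Suc by measurable
qed simp

text \<open>Turns the deviation of the binomial count from its mean into a sum of signs, to which
  the exponential moment bound for signs applies.\<close>

lemma moves_signs:
  assumes "\<And>j. j < i \<Longrightarrow> e (2 * j) \<in> {-1, 1}"
  shows "2 * real (moves e i) - real i = (\<Sum>j<i. e (2 * j))"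
  using assms
proof (induction i)
  case (Suc i)
  then have "2 * real (moves e i) - real i = (\<Sum>j<i. e (2 * j))" and "e (2 * i) \<in> {-1, 1}"
    by auto
  then show ?case by (auto simp: moves_Suc)
qed simp

lemma walk_Suc: "walk x (Suc n) = walk x n + x n"
  by (simp add: walk_def)

text \<open>The embedding identity: a moving pair contributes twice the next coarse step, and a loop
  contributes 0.\<close>

lemma walk_refine_even: "walk (refine x e) (2 * i) = 2 * walk x (moves e i)"
proof (induction i)
  case (Suc i)
  have "walk (refine x e) (2 * Suc i) =
      walk (refine x e) (2 * i) + refine x e (2 * i) + refine x e (Suc (2 * i))"
    by (simp add: walk_Suc)
  moreover have "refine x e (2 * i) + refine x e (Suc (2 * i)) =
      (if e (2 * i) = 1 then 2 * x (moves e i) else 0)"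
    by (simp add: refine_def)
  ultimately show ?case using Suc by (simp add: moves_Suc walk_Suc add.assoc)
qed (simp add: walk_def)

lemma walk_diff:
  "m \<le> n \<Longrightarrow> walk x n - walk x m = (\<Sum>k\<in>{m..<n}. x k)"
  unfolding walk_def lessThan_atLeast0 by (subst sum_diff_nat_ivl) auto

lemma refine_values:
  assumes "\<And>k. x k \<in> {-1, 1}" "\<And>k. e k \<in> {-1, 1}"
  shows "refine x e k \<in> {-1, 1}"
  using assms[of "moves e (k div 2)"] assms[of k] assms(2)[of "Suc k"]
  unfolding refine_def by auto

text \<open>
  A pattern \<open>a\<close> of \<open>2 j\<close> fine steps fixes exactly \<open>2 j\<close> distinct coins: the flag of each pair, and
  either the next unused coarse step or the sign of the pair.
\<close>

lemma refine_eq_iff: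
  fixes a :: "nat \<Rightarrow> real"
  assumes e: "\<And>k. e k \<in> {-1, 1}" and a: "\<And>k. k < 2 * j \<Longrightarrow> a k \<in> {-1, 1}"
  defines "F \<equiv> \<lambda>k. if even k then if a k = a (Suc k) then 1 else -1 else a (k - 1)"
  shows "(\<forall>k<2*j. refine x e k = a k) \<longleftrightarrow>
    (\<forall>i<j. e (2 * i) = F (2 * i) \<and>
      (if F (2 * i) = 1 then x (moves F i) else e (Suc (2 * i))) = F (Suc (2 * i)))"
proof -
  have pair: "refine x e (2 * i) = a (2 * i) \<and> refine x e (Suc (2 * i)) = a (Suc (2 * i)) \<longleftrightarrow>
      e (2 * i) = F (2 * i) \<and>
      (if F (2 * i) = 1 then x (moves e i) else e (Suc (2 * i))) = F (Suc (2 * i))"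
    if "i < j" for i
    using e[of "2 * i"] e[of "Suc (2 * i)"] a[of "2 * i"] a[of "Suc (2 * i)"] that
    by (auto simp: refine_def F_def)
  have "(\<forall>k<2*j. refine x e k = a k) \<longleftrightarrow>
      (\<forall>i<j. refine x e (2 * i) = a (2 * i) \<and> refine x e (Suc (2 * i)) = a (Suc (2 * i)))"
  proof (intro iffI allI impI)
    fix k assume *: "\<forall>i<j. refine x e (2 * i) = a (2 * i) \<and> refine x e (Suc (2 * i)) = a (Suc (2 * i))"
      and k: "k < 2 * j"
    then have "k div 2 < j" by auto
    then show "refine x e k = a k"
      using * by (cases "even k") (auto elim!: evenE oddE)
  qed auto
  also have "\<dots> \<longleftrightarrow> (\<forall>i<j. e (2 * i) = F (2 * i) \<and>
      (if F (2 * i) = 1 then x (moves e i) else e (Suc (2 * i))) = F (Suc (2 * i)))"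
    using pair by blast
  \<comment> \<open>Either side fixes the flags of all earlier pairs to those of \<open>F\<close>,
    so the coarse step read by pair \<open>i\<close> is located by the pattern alone; the random
    index becomes a fixed one.\<close>
  also have "\<dots> \<longleftrightarrow> (\<forall>i<j. e (2 * i) = F (2 * i) \<and>
      (if F (2 * i) = 1 then x (moves F i) else e (Suc (2 * i))) = F (Suc (2 * i)))"
  proof (rule iffI; intro allI impI)
    fix i assume "i < j" and *: "\<forall>i<j. e (2 * i) = F (2 * i) \<and>
      (if F (2 * i) = 1 then x (moves e i) else e (Suc (2 * i))) = F (Suc (2 * i))"
    moreover have "moves e i = moves F i" by (rule moves_cong) (use * \<open>i < j\<close> in auto)
    ultimately show "e (2 * i) = F (2 * i) \<and>
      (if F (2 * i) = 1 then x (moves F i) else e (Suc (2 * i))) = F (Suc (2 * i))" by metis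
  next
    fix i assume "i < j" and *: "\<forall>i<j. e (2 * i) = F (2 * i) \<and>
      (if F (2 * i) = 1 then x (moves F i) else e (Suc (2 * i))) = F (Suc (2 * i))"
    moreover have "moves e i = moves F i" by (rule moves_cong) (use * \<open>i < j\<close> in auto)
    ultimately show "e (2 * i) = F (2 * i) \<and>
      (if F (2 * i) = 1 then x (moves e i) else e (Suc (2 * i))) = F (Suc (2 * i))" by metis
  qed
  finally show ?thesis .
qed

section \<open>The law of the refined steps\<close>

context prob_space
begin

text \<open>A pattern of refined steps on complete pairs, together with coins of higher levels, is a
  pattern of equally many distinct coins of \<open>Y\<close>, hence has the probability that fair
  signs would give it. Here \<open>c\<close> is the component, \<open>l\<close> the level and
  \<open>k\<close> the number of a coin.\<close>

lemma fair_signs_refine: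
  fixes Y :: "'c::finite \<times> nat \<times> nat \<Rightarrow> 'a \<Rightarrow> real"
  assumes Y: "fair_signs {(c, l, k). m \<le> l} Y"
  defines "Z \<equiv> \<lambda>(c, l, k) \<omega>. if l = Suc m
    then refine (\<lambda>k. Y (c, m, k) \<omega>) (\<lambda>k. Y (c, Suc m, k) \<omega>) k else Y (c, l, k) \<omega>"
  shows "fair_signs {(c, l, k). Suc m \<le> l} Z"
proof (rule fair_signsI)
  note rv = fair_signs_rv[OF Y]
  fix i assume i: "i \<in> {(c :: 'c, l :: nat, k :: nat). Suc m \<le> l}"
  obtain c l k where [simp]: "i = (c, l, k)" by (cases i)
  have [measurable]: "Y (c, m, k) \<in> borel_measurable M" "Y (c, Suc m, k) \<in> borel_measurable M" for k
    by (rule rv; simp)+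
  have [measurable]: "(\<lambda>\<omega>. Y (c, m, moves (\<lambda>k. Y (c, Suc m, k) \<omega>) i) \<omega>) \<in> borel_measurable M" for i
    by (rule measurable_compose_countable[OF _ measurable_moves]) simp_all
  have "(\<lambda>\<omega>. refine (\<lambda>k. Y (c, m, k) \<omega>) (\<lambda>k. Y (c, Suc m, k) \<omega>) k) \<in> borel_measurable M"
    unfolding refine_def by measurable
  then show "Z i \<in> borel_measurable M"
    using i rv[of "(c, l, k)"] by (cases "l = Suc m") (auto simp: Z_def)
  fix \<omega> assume w: "\<omega> \<in> space M"
  show "Z i \<omega> \<in> {-1, 1}"
  proof (cases "l = Suc m")
    case True
    then show ?thesis
      using fair_signs_values[OF Y _ w] by (simp add: Z_def del: insert_iff) (intro refine_values; simp)
  next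
    case False
    then show ?thesis using i fair_signs_values[OF Y _ w, of i] by (simp add: Z_def)
  qed
next
  fix J assume J: "finite J" "J \<subseteq> {(c :: 'c, l :: nat, k :: nat). Suc m \<le> l}"
  \<comment> \<open>The cutoff \<open>2 * j\<close> exceeds every index in \<open>J\<close> and is
    even, so that no pair is cut in half; \<open>insert 0\<close> serves the empty
    \<open>J\<close>.\<close>
  define j where "j = Suc (Max (insert 0 ((\<lambda>(c, l, k). k) ` J)))"
  have j: "k < 2 * j" if "(c, l, k) \<in> J" for c l k
  proof -
    have "k \<in> (\<lambda>(c, l, k). k) ` J" using that by force
    then have "k \<le> Max (insert 0 ((\<lambda>(c, l, k). k) ` J))" using J(1) by (intro Max_ge) auto
    then show ?thesis by (simp add: j_def)
  qed
  define R where "R = {(c, l, k) \<in> J. l \<noteq> Suc m}"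
  define J' where "J' = (\<lambda>(c, k). (c, Suc m, k)) ` (UNIV \<times> {..<2 * j}) \<union> R"
  have inJ': "(c, Suc m, k) \<in> J'" if "k < 2 * j" for c k
    using that unfolding J'_def by force
  have fin_R: "finite R" using J(1) by (rule finite_subset[rotated]) (auto simp: R_def)
  then have fin: "finite J'" by (simp add: J'_def)
  have pattern: "prob {\<omega> \<in> space M. \<forall>i\<in>J'. Z i \<omega> = a i} = (1 / 2) ^ card J'"
    if a: "\<forall>i\<in>J'. a i \<in> {-1, 1}" for a
  proof -
    define F where "F c k = (if even k then if a (c, Suc m, k) = a (c, Suc m, Suc k) then 1 else -1
      else a (c, Suc m, k - 1))" for c k
    \<comment> \<open>The coin that decides an index under the given pattern: the second place of a
      moving pair is charged to the coarse step the pair uses, every other index to its own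
      coin.\<close>
    define coin where "coin = (\<lambda>(c, l, k). if l = Suc m \<and> odd k \<and> F c (k - 1) = 1
      then (c, m, moves (F c) (k div 2)) else (c, l, k))"
    define b where "b = (\<lambda>(c, l, k). if l = Suc m then F c k else a (c, l, k))"
    \<comment> \<open>The count \<open>moves\<close> jumps right after each moving pair, so no
      coarse step is used twice. This is what makes \<open>coin\<close> injective.\<close>
    have moves_inj: "k = k'" if "moves (F c) k = moves (F c) k'" "F c (2 * k) = 1" "F c (2 * k') = 1"
      for c k k'
    proof (rule ccontr)
      assume "k \<noteq> k'"
      then consider "Suc k \<le> k'" | "Suc k' \<le> k" by linarith
      then show False
        using that moves_mono[of "Suc k" k' "F c"] moves_mono[of "Suc k'" k "F c"]
        by cases (auto simp: moves_Suc)
    qed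
    have inj: "inj_on coin J'"
    proof (rule inj_onI)
      fix p q assume pq: "p \<in> J'" "q \<in> J'" and eq: "coin p = coin q"
      obtain c l k c' l' k' where [simp]: "p = (c, l, k)" "q = (c', l', k')" by (cases p, cases q)
      have l: "Suc m \<le> l" "Suc m \<le> l'" using pq J(2) by (auto simp: J'_def R_def)
      show "p = q"
      proof (cases "l = Suc m \<and> odd k \<and> F c (k - 1) = 1")
        case True
        with eq l have *: "l' = Suc m" "odd k'" "F c' (k' - 1) = 1" "c' = c"
          "moves (F c) (k div 2) = moves (F c) (k' div 2)"
          by (auto simp: coin_def split: if_splits)
        have "k - 1 = 2 * (k div 2)" "k' - 1 = 2 * (k' div 2)"
          using True *(2) by (auto elim!: oddE)
        then have "k div 2 = k' div 2" using moves_inj[OF *(5)] True * by simp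
        then show ?thesis using True * by (auto elim!: oddE)
      next
        case False
        with eq l show ?thesis by (auto simp: coin_def split: if_splits)
      qed
    qed
    have iff: "(\<forall>i\<in>J'. Z i \<omega> = a i) \<longleftrightarrow> (\<forall>i\<in>J'. Y (coin i) \<omega> = b i)" if w: "\<omega> \<in> space M" for \<omega>
    proof -
      have split: "(\<forall>i\<in>J'. P i) \<longleftrightarrow> (\<forall>c. \<forall>k<2*j. P (c, Suc m, k)) \<and> (\<forall>i\<in>R. P i)" for P
        unfolding J'_def ball_Un by auto
      have comp: "(\<forall>k<2*j. Z (c, Suc m, k) \<omega> = a (c, Suc m, k)) \<longleftrightarrow>
          (\<forall>k<2*j. Y (coin (c, Suc m, k)) \<omega> = b (c, Suc m, k))" for c
      proof -
        have F: "F c = (\<lambda>k. if even k then if a (c, Suc m, k) = a (c, Suc m, Suc k) then 1 else -1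
            else a (c, Suc m, k - 1))" by (simp add: F_def fun_eq_iff)
        have "(\<forall>k<2*j. Z (c, Suc m, k) \<omega> = a (c, Suc m, k)) \<longleftrightarrow>
          (\<forall>i<j. Y (c, Suc m, 2 * i) \<omega> = F c (2 * i) \<and>
            (if F c (2 * i) = 1 then Y (c, m, moves (F c) i) \<omega> else Y (c, Suc m, Suc (2 * i)) \<omega>)
              = F c (Suc (2 * i)))"
          unfolding Z_def F prod.case if_True simp_thms
        proof (rule refine_eq_iff)
          show "Y (c, Suc m, k) \<omega> \<in> {-1, 1}" for k
            using fair_signs_values[OF Y _ w, of "(c, Suc m, k)"] by simp
          show "a (c, Suc m, k) \<in> {-1, 1}" if "k < 2 * j" for k
            by (rule bspec[OF a inJ'[OF that]])
        qed
        also have "\<dots> \<longleftrightarrow> (\<forall>k<2*j. Y (coin (c, Suc m, k)) \<omega> = b (c, Suc m, k))"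
        proof (intro iffI allI impI)
          fix k assume *: "\<forall>i<j. Y (c, Suc m, 2 * i) \<omega> = F c (2 * i) \<and>
            (if F c (2 * i) = 1 then Y (c, m, moves (F c) i) \<omega> else Y (c, Suc m, Suc (2 * i)) \<omega>)
              = F c (Suc (2 * i))" and k: "k < 2 * j"
          then have "k div 2 < j" by auto
          then show "Y (coin (c, Suc m, k)) \<omega> = b (c, Suc m, k)"
            using *[rule_format, of "k div 2"]
            by (cases "even k") (auto simp: coin_def b_def elim!: evenE oddE split: if_splits)
        next
          fix i assume *: "\<forall>k<2*j. Y (coin (c, Suc m, k)) \<omega> = b (c, Suc m, k)" and i: "i < j"
          show "Y (c, Suc m, 2 * i) \<omega> = F c (2 * i) \<and>
            (if F c (2 * i) = 1 then Y (c, m, moves (F c) i) \<omega> else Y (c, Suc m, Suc (2 * i)) \<omega>)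
              = F c (Suc (2 * i))"
            using *[rule_format, of "2 * i"] *[rule_format, of "Suc (2 * i)"] i
            by (auto simp: coin_def b_def)
        qed
        finally show ?thesis .
      qed
      have rest: "Z i \<omega> = a i \<longleftrightarrow> Y (coin i) \<omega> = b i" if "i \<in> R" for i
        using that by (auto simp: R_def Z_def coin_def b_def)
      show ?thesis unfolding split using comp rest by blast
    qed
    have "{\<omega> \<in> space M. \<forall>i\<in>J'. Z i \<omega> = a i} =
        {\<omega> \<in> space M. \<forall>p\<in>coin ` J'. Y p \<omega> = b (the_inv_into J' coin p)}"
      using iff inj by (auto simp: the_inv_into_f_f)
    also have "prob \<dots> = (1 / 2) ^ card (coin ` J')"
    proof (rule fair_signs_pattern[OF Y])
      show "coin ` J' \<subseteq> {(c, l, k). m \<le> l}"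
        using J(2) by (auto simp: coin_def J'_def R_def split: if_splits)
      fix p assume "p \<in> coin ` J'"
      then obtain i where i: "i \<in> J'" "p = coin i" by auto
      obtain c l k where ic: "i = (c, l, k)" by (cases i)
      have "b i \<in> {-1, 1}"
      proof (cases "l = Suc m")
        case True
        then have "k < 2 * j" using i ic by (auto simp: J'_def R_def)
        then have "a (c, Suc m, k - 1) \<in> {-1, 1}" by (intro bspec[OF a] inJ') simp
        then show ?thesis using True ic by (auto simp: b_def F_def)
      next
        case False
        then show ?thesis using bspec[OF a i(1)] ic by (simp add: b_def)
      qed
      then show "b (the_inv_into J' coin p) \<in> {-1, 1}" using i inj by (simp add: the_inv_into_f_f)
    qed (use fin in simp)
    finally show ?thesis using inj by (simp add: card_image)
  qed
  show "\<exists>J'. finite J' \<and> J \<subseteq> J' \<and> J' \<subseteq> {(c, l, k). Suc m \<le> l} \<and>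
      (\<forall>a. (\<forall>i\<in>J'. a i \<in> {-1, 1}) \<longrightarrow>
        prob {\<omega> \<in> space M. \<forall>i\<in>J'. Z i \<omega> = a i} = (1 / 2) ^ card J')"
  proof (intro exI[of _ J'] conjI allI impI pattern fin)
    show "J \<subseteq> J'" using j by (auto simp: J'_def R_def)
    show "J' \<subseteq> {(c, l, k). Suc m \<le> l}" using J(2) by (auto simp: J'_def R_def)
  qed
qed

lemma fair_signs_cong:
  assumes "\<And>i \<omega>. i \<in> I \<Longrightarrow> X i \<omega> = Y i \<omega>"
  shows "fair_signs I X \<longleftrightarrow> fair_signs I Y"
proof -
  have *: "X i = Y i" if "i \<in> I" for i using assms that by blast
  have "indep_vars (\<lambda>_. borel) X I \<longleftrightarrow> indep_vars (\<lambda>_. borel) Y I"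
    by (rule indep_vars_cong) (auto simp: *)
  then show ?thesis unfolding fair_signs_def by (simp add: *)
qed

text \<open>The family keeps the unspent coins of all higher levels: the induction needs the steps
  of level \<open>m\<close> to be jointly fair with the coins that will refine them.\<close>

lemma fair_signs_steps:
  fixes X :: "'c::finite \<times> nat \<times> nat \<Rightarrow> 'a \<Rightarrow> real"
  assumes X: "fair_signs UNIV X"
  shows "fair_signs {(c, l, k). m \<le> l}
    (\<lambda>(c, l, k) \<omega>. if l = m then steps (\<lambda>l k. X (c, l, k) \<omega>) m k else X (c, l, k) \<omega>)"
proof (induction m)
  case 0
  have "(\<lambda>(c, l, k) \<omega>. if l = 0 then steps (\<lambda>l k. X (c, l, k) \<omega>) 0 k else X (c, l, k) \<omega>) = X"
    by (auto simp: fun_eq_iff)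
  moreover have "{(c :: 'c, l :: nat, k :: nat). 0 \<le> l} = UNIV" by auto
  ultimately show ?case using X by metis
next
  case (Suc m)
  show ?case
    by (rule fair_signs_cong[THEN iffD1, OF _ fair_signs_refine[OF Suc]]) auto
qed

end

subsection \<open>Exponential moments of the displacement\<close>

lemma cosh_le_exp_half_square: "cosh x \<le> exp (x\<^sup>2 / 2)" for x :: real
proof -
  have "cosh x \<le> exp (x\<^sup>2 / 2)" if "x \<ge> 0" for x :: real
  proof -
    \<comment> \<open>Hoeffding's inequality for a variable that takes two values at distance
      \<open>2 * x\<close> with probability 1/2 each; negative \<open>x\<close> follows since both
      sides are even.\<close>
    have *: "-(2 * x) * (1 / 2) + ln (1 + 1 / 2 * (exp (2 * x) - 1)) \<le> (2 * x)\<^sup>2 / 8"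
      using that by (intro Hoeffdings_lemma_aux) auto
    have pos: "0 < (1 + exp (2 * x)) / 2" by (simp add: add_pos_pos)
    from * have "exp (- x + ln ((1 + exp (2 * x)) / 2)) \<le> exp (x\<^sup>2 / 2)"
      by (simp add: field_simps power2_eq_square)
    also have "exp (- x + ln ((1 + exp (2 * x)) / 2)) = exp (- x) * ((1 + exp (2 * x)) / 2)"
      by (simp only: exp_add exp_ln[OF pos])
    also have "\<dots> = cosh x"
      by (simp add: cosh_def field_simps flip: exp_add)
    finally show ?thesis .
  qed
  from this[of "\<bar>x\<bar>"] show ?thesis by (simp add: cosh_real_abs)
qed

lemma exp_abs_le: "exp \<bar>x\<bar> \<le> exp x + exp (- x)" for x :: real
  by (cases "x \<ge> 0") auto

context prob_space
begin

text \<open>Vector-valued \<open>g\<close> covers both the real exponentials of the tail bounds and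
  the complex \<open>iexp\<close> of characteristic functions.\<close>

lemma
  fixes g :: "real \<Rightarrow> 'b :: {banach, second_countable_topology}"
  assumes X: "fair_signs I X" "i \<in> I"
  shows fair_signs_integrable: "integrable M (\<lambda>\<omega>. g (X i \<omega>))"
    and fair_signs_expectation: "(\<integral>\<omega>. g (X i \<omega>) \<partial>M) = (1 / 2) *\<^sub>R (g 1 + g (-1))"
proof -
  have [measurable]: "X i \<in> borel_measurable M" by (rule fair_signs_rv[OF X])
  let ?A = "\<lambda>s. {\<omega> \<in> space M. X i \<omega> = s}"
  let ?f = "\<lambda>\<omega>. indicator (?A 1) \<omega> *\<^sub>R g 1 + indicator (?A (-1)) \<omega> *\<^sub>R g (-1)"
  have eq: "g (X i \<omega>) = ?f \<omega>" if "\<omega> \<in> space M" for \<omega>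
    using fair_signs_values[OF X that] that by (auto simp: indicator_def)
  have int: "integrable M (\<lambda>\<omega>. indicator (?A s) \<omega> *\<^sub>R g s)" for s
    by (intro integrable_scaleR_left integrable_real_indicator)
      (auto simp: less_top[symmetric])
  then have "integrable M ?f" by (intro Bochner_Integration.integrable_add)
  then show "integrable M (\<lambda>\<omega>. g (X i \<omega>))"
    by (subst Bochner_Integration.integrable_cong[OF refl eq]) auto
  have "(\<integral>\<omega>. g (X i \<omega>) \<partial>M) = (\<integral>\<omega>. ?f \<omega> \<partial>M)"
    by (rule Bochner_Integration.integral_cong[OF refl eq])
  also have "\<dots> = prob (?A 1) *\<^sub>R g 1 + prob (?A (-1)) *\<^sub>R g (-1)"
    by (subst Bochner_Integration.integral_add[OF int int],
        subst (1 2) integral_scaleR_left) (auto simp: less_top[symmetric])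
  also have "\<dots> = (1 / 2) *\<^sub>R (g 1 + g (-1))"
    by (simp add: fair_signs_prob[OF X] scaleR_add_right)
  finally show "(\<integral>\<omega>. g (X i \<omega>) \<partial>M) = (1 / 2) *\<^sub>R (g 1 + g (-1))" .
qed

lemma
  assumes X: "fair_signs I X" and K: "finite K" "K \<subseteq> I"
  shows fair_signs_mgf_integrable: "integrable M (\<lambda>\<omega>. exp (t * (\<Sum>i\<in>K. X i \<omega>)))"
    and fair_signs_mgf_le: "expectation (\<lambda>\<omega>. exp (t * (\<Sum>i\<in>K. X i \<omega>))) \<le> exp (t\<^sup>2 / 2 * card K)"
proof -
  have "indep_vars (\<lambda>_. borel) X K"
    using fair_signs_subset[OF X K(2)] by (simp add: fair_signs_def)
  then have indep: "indep_vars (\<lambda>_. borel) (\<lambda>i \<omega>. exp (t * X i \<omega>)) K"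
    by (rule indep_vars_compose2) simp
  have int: "integrable M (\<lambda>\<omega>. exp (t * X i \<omega>))" if "i \<in> K" for i
    using K that by (intro fair_signs_integrable[OF X, of i "\<lambda>x. exp (t * x)"]) blast
  have eq: "exp (t * (\<Sum>i\<in>K. X i \<omega>)) = (\<Prod>i\<in>K. exp (t * X i \<omega>))" for \<omega>
    by (simp add: sum_distrib_left exp_sum K)
  show "integrable M (\<lambda>\<omega>. exp (t * (\<Sum>i\<in>K. X i \<omega>)))"
    unfolding eq by (rule indep_vars_integrable[OF K(1) indep int])
  have "expectation (\<lambda>\<omega>. exp (t * (\<Sum>i\<in>K. X i \<omega>))) = (\<Prod>i\<in>K. expectation (\<lambda>\<omega>. exp (t * X i \<omega>)))"
    unfolding eq by (rule indep_vars_lebesgue_integral[OF K(1) indep int])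
  also have "\<dots> = (\<Prod>i\<in>K. cosh t)"
  proof (rule prod.cong)
    fix i assume "i \<in> K"
    then have "i \<in> I" using K by blast
    from fair_signs_expectation[OF X this, of "\<lambda>x. exp (t * x)"]
    show "expectation (\<lambda>\<omega>. exp (t * X i \<omega>)) = cosh t" by (simp add: cosh_def)
  qed simp
  also have "\<dots> \<le> exp (t\<^sup>2 / 2) ^ card K"
    by (simp add: power_mono cosh_le_exp_half_square)
  also have "\<dots> = exp (t\<^sup>2 / 2 * card K)"
    by (simp add: exp_of_nat_mult[symmetric] mult.commute)
  finally show "expectation (\<lambda>\<omega>. exp (t * (\<Sum>i\<in>K. X i \<omega>))) \<le> exp (t\<^sup>2 / 2 * card K)" .
qed

text \<open>A walk increment in either direction of time is a sum of distinct signs, up to replacing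
  \<open>t\<close> by \<open>- t\<close>; hence the absolute value in the bound.\<close>

lemma
  fixes p :: "nat \<Rightarrow> 'i"
  assumes X: "fair_signs I X" and p: "inj p" "range p \<subseteq> I"
  defines "x \<equiv> \<lambda>\<omega> k. X (p k) \<omega>"
  shows walk_mgf_integrable: "integrable M (\<lambda>\<omega>. exp (t * (walk (x \<omega>) m - walk (x \<omega>) n)))"
    and walk_mgf_le: "expectation (\<lambda>\<omega>. exp (t * (walk (x \<omega>) m - walk (x \<omega>) n)))
      \<le> exp (t\<^sup>2 / 2 * \<bar>real m - real n\<bar>)"
proof -
  have eq: "walk (x \<omega>) b - walk (x \<omega>) a = (\<Sum>i\<in>p ` {a..<b}. X i \<omega>)" if "a \<le> b" for a b \<omega>
    using that by (simp add: walk_diff x_def sum.reindex[OF inj_on_subset[OF p(1)]])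
  have sub: "p ` {a..<b} \<subseteq> I" for a b using p by auto
  have card: "card (p ` {a..<b}) = b - a" for a b
    by (simp add: card_image[OF inj_on_subset[OF p(1)]])
  have *: "t * (walk (x \<omega>) m - walk (x \<omega>) n) =
    (if n \<le> m then t * (\<Sum>i\<in>p ` {n..<m}. X i \<omega>) else (- t) * (\<Sum>i\<in>p ` {m..<n}. X i \<omega>))" for \<omega>
    using eq[of n m \<omega>] eq[of m n \<omega>] by (auto simp: algebra_simps)
  show "integrable M (\<lambda>\<omega>. exp (t * (walk (x \<omega>) m - walk (x \<omega>) n)))"
    using fair_signs_mgf_integrable[OF X _ sub, of n m t]
      fair_signs_mgf_integrable[OF X _ sub, of m n "- t"]
    unfolding * by (cases "n \<le> m") auto
  show "expectation (\<lambda>\<omega>. exp (t * (walk (x \<omega>) m - walk (x \<omega>) n)))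
      \<le> exp (t\<^sup>2 / 2 * \<bar>real m - real n\<bar>)"
    using fair_signs_mgf_le[OF X _ sub, of n m t] fair_signs_mgf_le[OF X _ sub, of m n "- t"]
    unfolding * by (cases "n \<le> m") (auto simp: card of_nat_diff simp del: mult_minus_left)
qed

text \<open>The deviation from \<open>i / 2\<close> is half the sum of flags; the extra 1 pays for
  rounding \<open>i / 2\<close> down.\<close>

lemma abs_moves_diff:
  assumes "\<And>j. j < i \<Longrightarrow> e (2 * j) \<in> {-1, 1 :: real}"
  shows "\<bar>real (moves e i) - real (i div 2)\<bar> \<le> (\<bar>\<Sum>j<i. e (2 * j)\<bar> + 1) / 2"
proof -
  have "real i - 1 \<le> 2 * real (i div 2)" "2 * real (i div 2) \<le> real i" by linarith+
  moreover have "2 * real (moves e i) - real i = (\<Sum>j<i. e (2 * j))"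
    by (rule moves_signs) (rule assms)
  ultimately show ?thesis by (simp add: abs_le_iff abs_if split: if_splits)
qed

text \<open>Conditioned on the number \<open>N\<close> of moves, the walk increment has exponential
  moment at most \<open>exp (t\<^sup>2 / 2 * \<bar>N - i div 2\<bar>)\<close>. Up to rounding,
  \<open>\<bar>N - i div 2\<bar>\<close> is half the absolute value of a sum of \<open>i\<close>
  signs, so a second use of the bound for signs, at parameter \<open>t\<^sup>2 / 4\<close>, produces
  \<open>t ^ 4 * i / 32\<close>. The factor 2 comes from
  \<open>exp \<bar>x\<bar> \<le> exp x + exp (- x)\<close>, and \<open>t\<^sup>2 / 4\<close> from
  rounding.\<close>

lemma
  fixes p q :: "nat \<Rightarrow> 'i" and i :: nat
  assumes X: "fair_signs I X" and p: "inj p" "range p \<subseteq> I" and q: "inj q" "range q \<subseteq> I"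
    and pq: "range p \<inter> range q = {}"
  defines "x \<equiv> \<lambda>\<omega> k. X (p k) \<omega>" and "e \<equiv> \<lambda>\<omega> k. X (q k) \<omega>"
  shows displaced_walk_mgf_integrable:
      "integrable M (\<lambda>\<omega>. exp (t * (walk (x \<omega>) (moves (e \<omega>) i) - walk (x \<omega>) (i div 2))))"
    and displaced_walk_mgf_le:
      "expectation (\<lambda>\<omega>. exp (t * (walk (x \<omega>) (moves (e \<omega>) i) - walk (x \<omega>) (i div 2))))
        \<le> 2 * exp (t\<^sup>2 / 4 + t ^ 4 * i / 32)"
proof -
  define W where "W n \<omega> = exp (t * (walk (x \<omega>) n - walk (x \<omega>) (i div 2)))" for n \<omega>
  define N where "N \<omega> = moves (e \<omega>) i" for \<omega>
  have [measurable]: "X (p k) \<in> borel_measurable M" "X (q k) \<in> borel_measurable M" for k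
    using p(2) q(2) by (auto intro!: fair_signs_rv[OF X])
  have N_meas: "N \<in> measurable M (count_space UNIV)"
    unfolding N_def[abs_def] e_def by (rule measurable_moves) simp
  have intW: "integrable M (W n)" for n
    unfolding W_def[abs_def] x_def by (rule walk_mgf_integrable[OF X p])
  have EW: "expectation (W n) \<le> exp (t\<^sup>2 / 2 * \<bar>real n - real (i div 2)\<bar>)" for n
    unfolding W_def[abs_def] x_def by (rule walk_mgf_le[OF X p])
  \<comment> \<open>Conditioning on \<open>N\<close> is done by hand: since
    \<open>N \<le> i\<close>, a finite sum over the indicators \<open>A n\<close> suffices, and each
    \<open>A n\<close> is independent of \<open>W n\<close> because flags and coarse steps are
    disjoint sets of coins.\<close>
  define A :: "nat \<Rightarrow> 'a \<Rightarrow> real" where "A n = (\<lambda>\<omega>. indicator {n} (N \<omega>))" for n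
  have [measurable]: "A n \<in> borel_measurable M" for n
    unfolding A_def by (rule measurable_compose[OF N_meas]) simp
  have intA: "integrable M (A n)" for n
    by (rule integrable_const_bound[of _ 1]) (simp add: A_def indicator_def, measurable)
  have indep: "indep_var borel (A n) borel (W n)" for n
  proof -
    have "indep_var (PiM (range q) (\<lambda>_. borel)) (\<lambda>\<omega>. restrict (\<lambda>i. X i \<omega>) (range q))
        (PiM (range p) (\<lambda>_. borel)) (\<lambda>\<omega>. restrict (\<lambda>i. X i \<omega>) (range p))"
      using X p q pq by (intro indep_var_restrict) (auto simp: fair_signs_def)
    then have "indep_var borel ((\<lambda>h. indicator {n} (moves (\<lambda>k. h (q k)) i)) \<circ>
          (\<lambda>\<omega>. restrict (\<lambda>i. X i \<omega>) (range q)))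
        borel ((\<lambda>h. exp (t * (walk (\<lambda>k. h (p k)) n - walk (\<lambda>k. h (p k)) (i div 2)))) \<circ>
          (\<lambda>\<omega>. restrict (\<lambda>i. X i \<omega>) (range p)))"
    proof (rule indep_var_compose)
      have [measurable]: "(\<lambda>h. h j) \<in> borel_measurable (PiM J (\<lambda>_. borel :: real measure))"
        if "j \<in> J" for j :: 'i and J
        using that by (rule measurable_component_singleton)
      have moves: "(\<lambda>h. moves (\<lambda>k. h (q k)) i)
          \<in> measurable (PiM (range q) (\<lambda>_. borel)) (count_space UNIV)"
        by (rule measurable_moves) simp
      show "(\<lambda>h. indicator {n} (moves (\<lambda>k. h (q k)) i))
          \<in> borel_measurable (PiM (range q) (\<lambda>_. borel :: real measure))"
        by (rule measurable_compose[OF moves]) simp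
      show "(\<lambda>h. exp (t * (walk (\<lambda>k. h (p k)) n - walk (\<lambda>k. h (p k)) (i div 2))))
          \<in> borel_measurable (PiM (range p) (\<lambda>_. borel :: real measure))"
        unfolding walk_def by simp
    qed
    then show ?thesis
      by (simp add: comp_def A_def N_def W_def[abs_def] x_def e_def)
  qed
  have int: "integrable M (\<lambda>\<omega>. A n \<omega> * W n \<omega>)" for n
    by (rule indep_var_integrable[OF indep intA intW])
  have split: "f (N \<omega>) = (\<Sum>n\<le>i. A n \<omega> * f n)" if "\<omega> \<in> space M" for \<omega> and f :: "nat \<Rightarrow> real"
  proof -
    have "(\<Sum>n\<le>i. A n \<omega> * f n) = (\<Sum>n\<in>{N \<omega>}. A n \<omega> * f n)"
      using that moves_le[of "e \<omega>" i]
      by (intro sum.mono_neutral_right) (auto simp: A_def N_def indicator_def)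
    then show ?thesis using that by (simp add: A_def)
  qed
  have eq: "exp (t * (walk (x \<omega>) (moves (e \<omega>) i) - walk (x \<omega>) (i div 2)))
      = (\<Sum>n\<le>i. A n \<omega> * W n \<omega>)" if "\<omega> \<in> space M" for \<omega>
    using split[OF that, of "\<lambda>n. W n \<omega>"] by (simp add: W_def N_def)
  show "integrable M (\<lambda>\<omega>. exp (t * (walk (x \<omega>) (moves (e \<omega>) i) - walk (x \<omega>) (i div 2))))"
    by (subst Bochner_Integration.integrable_cong[OF refl eq]) (auto intro!: int)
  define F where "F \<omega> = (\<Sum>j\<in>(\<lambda>j. q (2 * j)) ` {..<i}. X j \<omega>)" for \<omega>
  have injq: "inj_on (\<lambda>j. q (2 * j)) {..<i}"
    using injD[OF q(1)] by (intro inj_onI) fastforce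
  have F_eq: "F \<omega> = (\<Sum>j<i. e \<omega> (2 * j))" for \<omega>
    by (simp add: F_def sum.reindex[OF injq] e_def)
  have F: "integrable M (\<lambda>\<omega>. exp (s * F \<omega>))"
    "expectation (\<lambda>\<omega>. exp (s * F \<omega>)) \<le> exp (s\<^sup>2 / 2 * i)" for s
    using fair_signs_mgf_integrable[OF X, of "(\<lambda>j. q (2 * j)) ` {..<i}" s]
      fair_signs_mgf_le[OF X, of "(\<lambda>j. q (2 * j)) ` {..<i}" s] q
    by (auto simp: F_def card_image[OF injq])
  have "expectation (\<lambda>\<omega>. exp (t * (walk (x \<omega>) (moves (e \<omega>) i) - walk (x \<omega>) (i div 2))))
      = (\<Sum>n\<le>i. expectation (\<lambda>\<omega>. A n \<omega> * W n \<omega>))"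
    by (subst Bochner_Integration.integral_cong[OF refl eq]) (auto intro!: Bochner_Integration.integral_sum int)
  also have "\<dots> = (\<Sum>n\<le>i. expectation (A n) * expectation (W n))"
    by (intro sum.cong refl, subst indep_var_lebesgue_integral[OF indep intA intW]) simp
  also have "\<dots> \<le> (\<Sum>n\<le>i. expectation (A n) * exp (t\<^sup>2 / 2 * \<bar>real n - real (i div 2)\<bar>))"
    by (intro sum_mono mult_left_mono EW) (auto simp: A_def)
  also have "\<dots> = expectation (\<lambda>\<omega>. \<Sum>n\<le>i. A n \<omega> * exp (t\<^sup>2 / 2 * \<bar>real n - real (i div 2)\<bar>))"
    by (subst Bochner_Integration.integral_sum) (auto intro!: intA)
  also have "\<dots> \<le> expectation (\<lambda>\<omega>. exp (t\<^sup>2 / 4) * (exp (t\<^sup>2 / 4 * F \<omega>) + exp ((- (t\<^sup>2) / 4) * F \<omega>)))"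
  proof (rule integral_mono)
    fix \<omega> assume w: "\<omega> \<in> space M"
    have "(\<Sum>n\<le>i. A n \<omega> * exp (t\<^sup>2 / 2 * \<bar>real n - real (i div 2)\<bar>))
        = exp (t\<^sup>2 / 2 * \<bar>real (N \<omega>) - real (i div 2)\<bar>)"
      using split[OF w, of "\<lambda>n. exp (t\<^sup>2 / 2 * \<bar>real n - real (i div 2)\<bar>)"] by simp
    also have "\<dots> \<le> exp (t\<^sup>2 / 2 * ((\<bar>F \<omega>\<bar> + 1) / 2))"
      unfolding exp_le_cancel_iff N_def F_eq
    proof (rule mult_left_mono[OF abs_moves_diff])
      show "e \<omega> (2 * j) \<in> {-1, 1}" for j
        unfolding e_def by (rule fair_signs_values[OF X _ w]) (use q in auto)
    qed simp
    also have "\<dots> = exp (t\<^sup>2 / 4) * exp \<bar>t\<^sup>2 / 4 * F \<omega>\<bar>"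
      by (simp add: abs_mult field_simps flip: exp_add)
    also have "\<dots> \<le> exp (t\<^sup>2 / 4) * (exp (t\<^sup>2 / 4 * F \<omega>) + exp (- (t\<^sup>2 / 4 * F \<omega>)))"
      by (intro mult_left_mono exp_abs_le) auto
    finally show "(\<Sum>n\<le>i. A n \<omega> * exp (t\<^sup>2 / 2 * \<bar>real n - real (i div 2)\<bar>))
        \<le> exp (t\<^sup>2 / 4) * (exp (t\<^sup>2 / 4 * F \<omega>) + exp ((- (t\<^sup>2) / 4) * F \<omega>))" by simp
  qed (use F(1)[of "t\<^sup>2 / 4"] F(1)[of "- (t\<^sup>2) / 4"] in
      \<open>auto intro!: intA integrable_mult_right Bochner_Integration.integrable_add\<close>)
  also have "\<dots> = exp (t\<^sup>2 / 4) * (expectation (\<lambda>\<omega>. exp (t\<^sup>2 / 4 * F \<omega>))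
      + expectation (\<lambda>\<omega>. exp ((- (t\<^sup>2) / 4) * F \<omega>)))"
    by (subst integral_mult_right_zero, subst Bochner_Integration.integral_add[OF F(1) F(1)]) simp
  also have "\<dots> \<le> exp (t\<^sup>2 / 4) * (exp ((t\<^sup>2 / 4)\<^sup>2 / 2 * i) + exp ((- (t\<^sup>2) / 4)\<^sup>2 / 2 * i))"
    by (intro mult_left_mono add_mono F) auto
  also have "\<dots> = 2 * exp (t\<^sup>2 / 4 + t ^ 4 * i / 32)"
  proof -
    have "(t\<^sup>2 / 4)\<^sup>2 / 2 * i = t ^ 4 * i / 32" "(- (t\<^sup>2) / 4)\<^sup>2 / 2 * i = t ^ 4 * i / 32"
      by (simp_all add: power_divide flip: power_mult)
    then show ?thesis by (simp only: exp_add) simp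
  qed
  finally show "expectation (\<lambda>\<omega>. exp (t * (walk (x \<omega>) (moves (e \<omega>) i) - walk (x \<omega>) (i div 2))))
        \<le> 2 * exp (t\<^sup>2 / 4 + t ^ 4 * i / 32)" .
qed

text \<open>Chernoff bound for both signs of \<open>D\<close>, each with the factor 2 of the
  exponential moment.\<close>

lemma displaced_walk_tail:
  fixes p q :: "nat \<Rightarrow> 'i" and i :: nat and t y :: real
  assumes X: "fair_signs I X" and p: "inj p" "range p \<subseteq> I" and q: "inj q" "range q \<subseteq> I"
    and pq: "range p \<inter> range q = {}" and t: "t > 0"
  defines "D \<equiv> \<lambda>\<omega>. walk (\<lambda>k. X (p k) \<omega>) (moves (\<lambda>k. X (q k) \<omega>) i) - walk (\<lambda>k. X (p k) \<omega>) (i div 2)"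
  shows "D \<in> borel_measurable M"
    and "prob {\<omega> \<in> space M. y \<le> \<bar>D \<omega>\<bar>} \<le> 4 * exp (t\<^sup>2 / 4 + t ^ 4 * i / 32 - t * y)"
proof -
  have int: "integrable M (\<lambda>\<omega>. exp (s * D \<omega>))" for s
    unfolding D_def by (rule displaced_walk_mgf_integrable[OF X p q pq])
  have le: "expectation (\<lambda>\<omega>. exp (s * D \<omega>)) \<le> 2 * exp (s\<^sup>2 / 4 + s ^ 4 * i / 32)" for s
    unfolding D_def by (rule displaced_walk_mgf_le[OF X p q pq])
  \<comment> \<open>\<open>D\<close> reads the walk at a random index; its measurability is
    recovered from the integrability of its exponential.\<close>
  have "(\<lambda>\<omega>. ln (exp (1 * D \<omega>))) \<in> borel_measurable M"
    by (intro borel_measurable_ln borel_measurable_integrable int)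
  then show [measurable]: "D \<in> borel_measurable M" by simp
  have tail: "prob {\<omega> \<in> space M. y \<le> s * D \<omega>} \<le> 2 * exp (t\<^sup>2 / 4 + t ^ 4 * i / 32 - t * y)"
    if s: "s = 1 \<or> s = -1" for s
  proof -
    have "{\<omega> \<in> space M. y \<le> s * D \<omega>} = {\<omega> \<in> space M. exp (t * y) \<le> exp ((t * s) * D \<omega>)}"
      using t by auto
    also have "prob \<dots> \<le> expectation (\<lambda>\<omega>. exp ((t * s) * D \<omega>)) / exp (t * y)"
      by (rule integral_Markov_inequality_measure[OF int]) auto
    also have "\<dots> \<le> 2 * exp ((t * s)\<^sup>2 / 4 + (t * s) ^ 4 * i / 32) / exp (t * y)"
      by (intro divide_right_mono le) auto
    also have "\<dots> = 2 * exp (t\<^sup>2 / 4 + t ^ 4 * i / 32 - t * y)"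
      using s by (auto simp: exp_diff power_mult_distrib)
    finally show ?thesis .
  qed
  have "prob {\<omega> \<in> space M. y \<le> \<bar>D \<omega>\<bar>}
      \<le> prob ({\<omega> \<in> space M. y \<le> 1 * D \<omega>} \<union> {\<omega> \<in> space M. y \<le> -1 * D \<omega>})"
    by (intro finite_measure_mono) auto
  also have "\<dots> \<le> prob {\<omega> \<in> space M. y \<le> 1 * D \<omega>} + prob {\<omega> \<in> space M. y \<le> -1 * D \<omega>}"
    by (intro measure_Un_le) auto
  also have "\<dots> \<le> 4 * exp (t\<^sup>2 / 4 + t ^ 4 * i / 32 - t * y)"
    using tail[of 1] tail[of "-1"] by simp
  finally show "prob {\<omega> \<in> space M. y \<le> \<bar>D \<omega>\<bar>} \<le> 4 * exp (t\<^sup>2 / 4 + t ^ 4 * i / 32 - t * y)" .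
qed

end

subsection \<open>Limits of independent and of binomial variables\<close>

lemma open_indicator_approx:
  fixes A :: "'b::metric_space set"
  assumes "open A"
  obtains u :: "nat \<Rightarrow> 'b \<Rightarrow> real" where
    "\<And>k. continuous_on UNIV (u k)" "\<And>k x. 0 \<le> u k x" "\<And>k x. u k x \<le> 1"
    "\<And>x. (\<lambda>k. u k x) \<longlonglongrightarrow> indicator A x"
\<comment> \<open>The distance to an empty complement is 0 by convention, which would give the limit
  0 instead of 1.\<close>
proof (cases "A = UNIV")
  case True
  then show ?thesis by (intro that[of "\<lambda>_ _. 1"]) auto
next
  case False
  define u where "u k x = min 1 (real k * infdist x (- A))" for k x
  show ?thesis
  proof (rule that[of u])
    show "continuous_on UNIV (u k)" for k
      unfolding u_def by (intro continuous_intros)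
    show "(\<lambda>k. u k x) \<longlonglongrightarrow> indicator A x" for x
    proof (cases "x \<in> A")
      case True
      then have pos: "infdist x (- A) > 0"
        using False assms by (intro infdist_pos_not_in_closed) auto
      obtain K where K: "1 / infdist x (- A) < real K" using reals_Archimedean2 by blast
      have "eventually (\<lambda>k. u k x = 1) sequentially"
        using eventually_ge_at_top[of K]
      proof eventually_elim
        case (elim k)
        have "1 < real K * infdist x (- A)" using K pos by (simp add: field_simps)
        also have "\<dots> \<le> real k * infdist x (- A)" using elim pos by (intro mult_right_mono) auto
        finally show ?case by (simp add: u_def)
      qed
      then show ?thesis using True by (simp add: tendsto_eventually)
    next
      case False
      then show ?thesis by (simp add: u_def)
    qed
  qed (auto simp: u_def infdist_nonneg)
qed

context prob_space
begin

text \<open>Product formulas for bounded continuous functions survive almost sure limits by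
  dominated convergence. A second limit replaces these functions by indicators of open sets, an
  intersection-stable generator of the Borel sets.\<close>

lemma indep_vars_limit:
  fixes Y :: "nat \<Rightarrow> 'i \<Rightarrow> 'a \<Rightarrow> 'b::metric_space"
  assumes I: "finite I"
    and indep: "\<And>n. indep_vars (\<lambda>_. borel) (Y n) I"
    and Z: "\<And>i. i \<in> I \<Longrightarrow> Z i \<in> borel_measurable M"
    and lim: "\<And>i. i \<in> I \<Longrightarrow> AE \<omega> in M. (\<lambda>n. Y n i \<omega>) \<longlonglongrightarrow> Z i \<omega>"
  shows "indep_vars (\<lambda>_. borel) Z I"
proof (cases "I = {}")
  case True
  then show ?thesis by (simp add: indep_vars_def2 indep_sets_def)
next
  case False
  have Ym: "Y n i \<in> borel_measurable M" if "i \<in> I" for n i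
    using indep that by (auto simp: indep_vars_def2)
  have opens: "prob (\<Inter>j\<in>I. Z j -` A j \<inter> space M) = (\<Prod>j\<in>I. prob (Z j -` A j \<inter> space M))"
    if A: "\<And>i. i \<in> I \<Longrightarrow> open (A i)" for A
  proof -
    have "\<exists>u. (\<forall>k. continuous_on UNIV (u k)) \<and> (\<forall>k x. 0 \<le> u k x) \<and> (\<forall>k x. u k x \<le> (1::real)) \<and>
        (\<forall>x. (\<lambda>k. u k x) \<longlonglongrightarrow> indicator (A i) x)" if "i \<in> I" for i
      by (rule open_indicator_approx[OF A[OF that]]) blast
    then obtain u where u': "\<And>i. i \<in> I \<Longrightarrow> (\<forall>k. continuous_on UNIV (u i k)) \<and> (\<forall>k x. 0 \<le> u i k x) \<and>
        (\<forall>k x. u i k x \<le> (1::real)) \<and> (\<forall>x. (\<lambda>k. u i k x) \<longlonglongrightarrow> indicator (A i) x)"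
      by metis
    then have u: "\<And>i k. i \<in> I \<Longrightarrow> continuous_on UNIV (u i k)"
      "\<And>i k x. i \<in> I \<Longrightarrow> 0 \<le> u i k x" "\<And>i k x. i \<in> I \<Longrightarrow> u i k x \<le> (1::real)"
      "\<And>i x. i \<in> I \<Longrightarrow> (\<lambda>k. u i k x) \<longlonglongrightarrow> indicator (A i) x"
      by blast+
    have um: "u i k \<in> borel_measurable borel" if "i \<in> I" for i k
      using u(1)[OF that] by (rule borel_measurable_continuous_onI)
    have uY: "(\<lambda>\<omega>. u i k (Y n i \<omega>)) \<in> borel_measurable M"
      and uZ: "(\<lambda>\<omega>. u i k (Z i \<omega>)) \<in> borel_measurable M" if "i \<in> I" for i k n
      using measurable_compose[OF Ym um] measurable_compose[OF Z um] that by auto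
    have prod_le: "norm (\<Prod>i\<in>I. u i k (x i)) \<le> 1" for k x
      using u(2,3) by (auto simp: abs_prod intro!: prod_le_1)
    have single_le: "norm (u i k x) \<le> 1" if "i \<in> I" for i k x
      using u(2,3)[OF that, of k x] by simp
    have limY: "AE \<omega> in M. (\<lambda>n. u i k (Y n i \<omega>)) \<longlonglongrightarrow> u i k (Z i \<omega>)" if "i \<in> I" for i k
      using lim[OF that]
    proof eventually_elim
      case (elim \<omega>)
      have "isCont (u i k) (Z i \<omega>)" using u(1)[OF that] by (simp add: continuous_on_eq_continuous_at)
      then show ?case using elim by (rule isCont_tendsto_compose)
    qed
    have factor: "expectation (\<lambda>\<omega>. \<Prod>i\<in>I. u i k (Z i \<omega>)) = (\<Prod>i\<in>I. expectation (\<lambda>\<omega>. u i k (Z i \<omega>)))"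
      for k
    proof (rule LIMSEQ_unique)
      show "(\<lambda>n. expectation (\<lambda>\<omega>. \<Prod>i\<in>I. u i k (Y n i \<omega>)))
          \<longlonglongrightarrow> expectation (\<lambda>\<omega>. \<Prod>i\<in>I. u i k (Z i \<omega>))"
      proof (rule integral_dominated_convergence[where w = "\<lambda>_. 1"])
        have "AE \<omega> in M. \<forall>i\<in>I. (\<lambda>n. u i k (Y n i \<omega>)) \<longlonglongrightarrow> u i k (Z i \<omega>)"
          using limY by (intro AE_finite_allI I)
        then show "AE \<omega> in M. (\<lambda>n. \<Prod>i\<in>I. u i k (Y n i \<omega>)) \<longlonglongrightarrow> (\<Prod>i\<in>I. u i k (Z i \<omega>))"
          by eventually_elim (intro tendsto_prod, auto)
      qed (use prod_le uY uZ in \<open>auto intro!: borel_measurable_prod simp del: real_norm_def\<close>)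
      have "expectation (\<lambda>\<omega>. \<Prod>i\<in>I. u i k (Y n i \<omega>)) = (\<Prod>i\<in>I. expectation (\<lambda>\<omega>. u i k (Y n i \<omega>)))" for n
      proof (rule indep_vars_lebesgue_integral[OF I])
        show "indep_vars (\<lambda>_. borel) (\<lambda>i \<omega>. u i k (Y n i \<omega>)) I"
          by (rule indep_vars_compose2[OF indep um])
        show "integrable M (\<lambda>\<omega>. u i k (Y n i \<omega>))" if "i \<in> I" for i
          by (rule integrable_const_bound[of _ 1]) (use single_le[OF that] uY[OF that] in auto)
      qed
      moreover have "(\<lambda>n. \<Prod>i\<in>I. expectation (\<lambda>\<omega>. u i k (Y n i \<omega>)))
          \<longlonglongrightarrow> (\<Prod>i\<in>I. expectation (\<lambda>\<omega>. u i k (Z i \<omega>)))"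
        by (intro tendsto_prod integral_dominated_convergence[where w = "\<lambda>_. 1"])
          (use single_le uY uZ limY in \<open>auto simp del: real_norm_def\<close>)
      ultimately show "(\<lambda>n. expectation (\<lambda>\<omega>. \<Prod>i\<in>I. u i k (Y n i \<omega>)))
          \<longlonglongrightarrow> (\<Prod>i\<in>I. expectation (\<lambda>\<omega>. u i k (Z i \<omega>)))" by simp
    qed
    have meas_ind: "(\<lambda>\<omega>. indicat_real (A i) (Z i \<omega>)) \<in> borel_measurable M" if "i \<in> I" for i
      by (rule measurable_compose[OF Z[OF that]]) (use A[OF that] in simp)
    have "expectation (\<lambda>\<omega>. \<Prod>i\<in>I. indicat_real (A i) (Z i \<omega>)) =
        (\<Prod>i\<in>I. expectation (\<lambda>\<omega>. indicat_real (A i) (Z i \<omega>)))"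
    proof (rule LIMSEQ_unique)
      show "(\<lambda>k. expectation (\<lambda>\<omega>. \<Prod>i\<in>I. u i k (Z i \<omega>)))
          \<longlonglongrightarrow> expectation (\<lambda>\<omega>. \<Prod>i\<in>I. indicat_real (A i) (Z i \<omega>))"
        by (rule integral_dominated_convergence[where w = "\<lambda>_. 1"])
          (use prod_le uZ meas_ind u(4) in \<open>auto intro!: borel_measurable_prod tendsto_prod simp del: real_norm_def\<close>)
      show "(\<lambda>k. expectation (\<lambda>\<omega>. \<Prod>i\<in>I. u i k (Z i \<omega>)))
          \<longlonglongrightarrow> (\<Prod>i\<in>I. expectation (\<lambda>\<omega>. indicat_real (A i) (Z i \<omega>)))"
        unfolding factor
        by (intro tendsto_prod integral_dominated_convergence[where w = "\<lambda>_. 1"])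
          (use single_le uZ meas_ind u(4) in \<open>auto simp del: real_norm_def\<close>)
    qed
    moreover have "expectation (\<lambda>\<omega>. indicat_real (A i) (Z i \<omega>)) = prob (Z i -` A i \<inter> space M)"
      if "i \<in> I" for i
    proof -
      have "expectation (\<lambda>\<omega>. indicat_real (A i) (Z i \<omega>)) = expectation (indicator (Z i -` A i \<inter> space M))"
        by (intro Bochner_Integration.integral_cong) (auto simp: indicator_def)
      then show ?thesis by simp
    qed
    moreover have "expectation (\<lambda>\<omega>. \<Prod>i\<in>I. indicat_real (A i) (Z i \<omega>)) = prob (\<Inter>j\<in>I. Z j -` A j \<inter> space M)"
    proof -
      have "(\<Prod>i\<in>I. indicat_real (A i) (Z i \<omega>)) = indicator (\<Inter>j\<in>I. Z j -` A j \<inter> space M) \<omega>"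
        if "\<omega> \<in> space M" for \<omega>
        using I False that by (auto simp: indicator_def prod_zero_iff)
      then have "expectation (\<lambda>\<omega>. \<Prod>i\<in>I. indicat_real (A i) (Z i \<omega>)) =
          expectation (indicator (\<Inter>j\<in>I. Z j -` A j \<inter> space M))"
        by (intro Bochner_Integration.integral_cong) auto
      also have "\<dots> = prob ((\<Inter>j\<in>I. Z j -` A j \<inter> space M) \<inter> space M)"
        by simp
      also have "(\<Inter>j\<in>I. Z j -` A j \<inter> space M) \<inter> space M = (\<Inter>j\<in>I. Z j -` A j \<inter> space M)"
        using False by auto
      finally show ?thesis .
    qed
    ultimately show ?thesis by simp
  qed
  have "indep_vars (\<lambda>_. borel) Z I \<longleftrightarrow> (\<forall>A\<in>(\<Pi> i\<in>I. {S. open S}).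
      prob (\<Inter>j\<in>I. Z j -` A j \<inter> space M) = (\<Prod>j\<in>I. prob (Z j -` A j \<inter> space M)))"
    by (rule indep_vars_finite[OF False I])
      (use Z in \<open>auto simp: borel_def Int_stable_def sets_measure_of\<close>)
  then show ?thesis using opens by (simp add: Pi_iff)
qed

text \<open>\<open>cos (t * a) ^ k\<close> is the characteristic function of \<open>a\<close> times
  a sum of \<open>k\<close> fair signs. The limit comes from \<open>ln (cos x) / x\<^sup>2\<close>
  tending to -1/2 at 0.\<close>

lemma cos_power_limit:
  fixes a :: "nat \<Rightarrow> real" and v t :: real
  assumes a: "\<And>m. a m > 0" "a \<longlonglongrightarrow> 0" and v: "(\<lambda>m. (a m)\<^sup>2 * real (k m)) \<longlonglongrightarrow> v"
  shows "(\<lambda>m. cos (t * a m) ^ k m) \<longlonglongrightarrow> exp (- (t\<^sup>2 * v) / 2)"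
proof (cases "t = 0")
  case True
  then show ?thesis by simp
next
  case False
  have lim: "((\<lambda>x. ln (cos x) / x\<^sup>2) \<longlongrightarrow> - (1 / 2)) (at (0 :: real))"
    by real_asymp
  have ta: "filterlim (\<lambda>m. t * a m) (at 0) sequentially"
    using False a(1) tendsto_mult_right_zero[OF a(2), of t]
    by (auto simp: filterlim_at less_imp_neq[symmetric] intro!: always_eventually)
  have "(\<lambda>m. t\<^sup>2 * ((a m)\<^sup>2 * real (k m)) * (ln (cos (t * a m)) / (t * a m)\<^sup>2)) \<longlonglongrightarrow> t\<^sup>2 * v * - (1 / 2)"
    by (intro tendsto_mult tendsto_const v filterlim_compose[OF lim ta])
  then have "(\<lambda>m. exp (t\<^sup>2 * ((a m)\<^sup>2 * real (k m)) * (ln (cos (t * a m)) / (t * a m)\<^sup>2)))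
      \<longlonglongrightarrow> exp (t\<^sup>2 * v * - (1 / 2))"
    by (rule tendsto_exp)
  moreover have "eventually (\<lambda>m. exp (t\<^sup>2 * ((a m)\<^sup>2 * real (k m)) * (ln (cos (t * a m)) / (t * a m)\<^sup>2))
      = cos (t * a m) ^ k m) sequentially"
  proof -
    have "((\<lambda>x. cos x) \<longlongrightarrow> (cos 0 :: real)) (at 0)" by (intro tendsto_intros)
    then have "eventually (\<lambda>x. cos x > (0 :: real)) (at 0)" by (rule order_tendstoD) simp
    then have "eventually (\<lambda>m. cos (t * a m) > 0) sequentially" using ta by (rule eventually_compose_filterlim)
    then show ?thesis
    proof eventually_elim
      case (elim m)
      have "t\<^sup>2 * ((a m)\<^sup>2 * real (k m)) * (ln (cos (t * a m)) / (t * a m)\<^sup>2) = real (k m) * ln (cos (t * a m))"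
        using False a(1)[of m] by (simp add: power_mult_distrib)
      then show ?case using elim by (simp add: exp_of_nat_mult)
    qed
  qed
  ultimately show ?thesis by (simp add: tendsto_cong)
qed

lemma distributed_normalI_char:
  assumes X [measurable]: "X \<in> borel_measurable M" and v: "v > 0"
    and char: "\<And>t. (CLINT \<omega>|M. iexp (t * X \<omega>)) = exp (- (t\<^sup>2 * v) / 2)"
  shows "distributed M lborel X (normal_density 0 (sqrt v))"
proof -
  define Z where "Z \<omega> = (X \<omega> - 0) / sqrt v" for \<omega>
  have [measurable]: "Z \<in> borel_measurable M" unfolding Z_def by measurable
  have "distr M borel Z = std_normal_distribution"
  proof (rule Levy_uniqueness)
    show "real_distribution (distr M borel Z)" by (rule real_distribution_distr) simp
    show "real_distribution std_normal_distribution" by (rule real_dist_normal_dist)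
    show "char (distr M borel Z) = char std_normal_distribution"
    proof
      fix t
      have "char (distr M borel Z) t = (CLINT \<omega>|M. iexp (t / sqrt v * X \<omega>))"
        by (simp add: char_def integral_distr Z_def)
      also have "\<dots> = exp (- ((t / sqrt v)\<^sup>2 * v) / 2)" by (rule char)
      also have "(t / sqrt v)\<^sup>2 * v = t\<^sup>2" using v by (simp add: power_divide)
      finally show "char (distr M borel Z) t = char std_normal_distribution t"
        by (simp add: char_std_normal_distribution)
    qed
  qed
  moreover have "distr M lborel Z = distr M borel Z" by (intro distr_cong) auto
  ultimately have "distributed M lborel Z std_normal_density"
    by (simp add: distributed_def)
  then show ?thesis
    unfolding Z_def by (subst normal_standard_normal_convert) (use v in auto)
qed

text \<open>A central limit theorem in which the sums already converge almost surely: dominated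
  convergence carries the characteristic functions to that of \<open>D\<close>, and uniqueness
  identifies the law.\<close>

lemma fair_signs_limit_normal:
  assumes X: "\<And>m. fair_signs (I m) (X m)" and K: "\<And>m. finite (K m)" "\<And>m. K m \<subseteq> I m"
    and a: "\<And>m. a m > 0" "a \<longlonglongrightarrow> 0" and v: "(\<lambda>m. (a m)\<^sup>2 * real (card (K m))) \<longlonglongrightarrow> v" "v > 0"
    and D: "D \<in> borel_measurable M" and lim: "AE \<omega> in M. (\<lambda>m. a m * (\<Sum>i\<in>K m. X m i \<omega>)) \<longlonglongrightarrow> D \<omega>"
  shows "distributed M lborel D (normal_density 0 (sqrt v))"
proof (rule distributed_normalI_char[OF D v(2)])
  fix t
  have Xm: "X m i \<in> borel_measurable M" if "i \<in> K m" for m i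
    using fair_signs_rv[OF X] K(2) that by blast
  have Sm [measurable]: "(\<lambda>\<omega>. \<Sum>i\<in>K m. X m i \<omega>) \<in> borel_measurable M" for m
    using Xm by (rule borel_measurable_sum)
  have "(CLINT \<omega>|M. iexp (t * (a m * (\<Sum>i\<in>K m. X m i \<omega>)))) = complex_of_real (cos (t * a m) ^ card (K m))" for m
  proof -
    have eq: "iexp (t * (a m * (\<Sum>i\<in>K m. X m i \<omega>))) = (\<Prod>i\<in>K m. iexp (t * a m * X m i \<omega>))" for \<omega>
      by (simp add: sum_distrib_left exp_sum K mult.assoc)
    have "indep_vars (\<lambda>_. borel) (X m) (K m)"
      using fair_signs_subset[OF X K(2)] by (simp add: fair_signs_def)
    then have "indep_vars (\<lambda>_. borel) (\<lambda>i \<omega>. iexp (t * a m * X m i \<omega>)) (K m)"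
      by (rule indep_vars_compose2) simp
    then have "(CLINT \<omega>|M. iexp (t * (a m * (\<Sum>i\<in>K m. X m i \<omega>)))) =
        (\<Prod>i\<in>K m. CLINT \<omega>|M. iexp (t * a m * X m i \<omega>))"
      unfolding eq using K
      by (intro indep_vars_lebesgue_integral fair_signs_integrable[OF X, where g = "\<lambda>x. iexp (t * a m * x)"]) auto
    also have "\<dots> = (\<Prod>i\<in>K m. complex_of_real (cos (t * a m)))"
    proof (rule prod.cong)
      fix i assume "i \<in> K m"
      then have "i \<in> I m" using K by blast
      from fair_signs_expectation[OF X this, of "\<lambda>x. iexp (t * a m * x)"]
      show "(CLINT \<omega>|M. iexp (t * a m * X m i \<omega>)) = complex_of_real (cos (t * a m))"
        by (simp add: complex_eq_iff Re_exp Im_exp)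
    qed simp
    finally show ?thesis by simp
  qed
  moreover have "(\<lambda>m. CLINT \<omega>|M. iexp (t * (a m * (\<Sum>i\<in>K m. X m i \<omega>)))) \<longlonglongrightarrow> (CLINT \<omega>|M. iexp (t * D \<omega>))"
  proof (rule integral_dominated_convergence[where w = "\<lambda>_. 1"])
    show "AE \<omega> in M. (\<lambda>m. iexp (t * (a m * (\<Sum>i\<in>K m. X m i \<omega>)))) \<longlonglongrightarrow> iexp (t * D \<omega>)"
      using lim by eventually_elim (intro tendsto_intros, auto)
    show "(\<lambda>\<omega>. iexp (t * D \<omega>)) \<in> borel_measurable M" using D by measurable
    show "(\<lambda>\<omega>. iexp (t * (a m * (\<Sum>i\<in>K m. X m i \<omega>)))) \<in> borel_measurable M" for m by measurable
    show "AE \<omega> in M. norm (iexp (t * (a m * (\<Sum>i\<in>K m. X m i \<omega>)))) \<le> 1" for m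
      by (simp del: of_real_mult)
  qed simp
  moreover have "(\<lambda>m. complex_of_real (cos (t * a m) ^ card (K m))) \<longlonglongrightarrow> complex_of_real (exp (- (t\<^sup>2 * v) / 2))"
    by (intro tendsto_of_real cos_power_limit a v)
  ultimately show "(CLINT \<omega>|M. iexp (t * D \<omega>)) = exp (- (t\<^sup>2 * v) / 2)"
    by (simp only: LIMSEQ_unique)
qed

text \<open>Rotation invariance of the Gaussian: \<open>(u + w)\<^sup>2 + (u - w)\<^sup>2 = 2 *
  (u\<^sup>2 + w\<^sup>2)\<close>, so the joint density at \<open>(u + w, u - w)\<close> again
  splits into a product, with half the variance.\<close>

lemma distributed_normal_rotation:
  fixes X Y :: "'a \<Rightarrow> real"
  assumes indep: "indep_var borel X borel Y" and v: "v > 0"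
    and X: "distributed M lborel X (normal_density 0 (sqrt (2 * v)))"
    and Y: "distributed M lborel Y (normal_density 0 (sqrt (2 * v)))"
  shows "distributed M lborel (\<lambda>\<omega>. ((X \<omega> + Y \<omega>) / 2, (X \<omega> - Y \<omega>) / 2))
    (\<lambda>(x, y). ennreal (normal_density 0 (sqrt v) x * normal_density 0 (sqrt v) y))"
proof -
  let ?\<phi> = "normal_density 0 (sqrt (2 * v))" and ?\<psi> = "normal_density 0 (sqrt v)"
  have [measurable]: "X \<in> borel_measurable M" "Y \<in> borel_measurable M"
    using indep by (auto dest: indep_var_rv1 indep_var_rv2)
  have "indep_var lborel X lborel Y"
    using indep_var_compose[OF indep, of "\<lambda>x. x" lborel "\<lambda>x. x" lborel] by (simp add: comp_def)
  from distributed_joint_indep[OF sigma_finite_lborel sigma_finite_lborel X Y this]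
  have joint: "distributed M (lborel \<Otimes>\<^sub>M lborel) (\<lambda>\<omega>. (X \<omega>, Y \<omega>)) (\<lambda>(x, y). ennreal (?\<phi> x) * ennreal (?\<phi> y))" .
  \<comment> \<open>The factor 2 is the absolute Jacobian determinant of
    \<open>(u, w) \<mapsto> (u + w, u - w)\<close>.\<close>
  have density_eq: "2 * ennreal (?\<phi> (u + w) * ?\<phi> (u - w)) = ennreal (?\<psi> u * ?\<psi> w)" for u w
  proof -
    have "2 * (?\<phi> (u + w) * ?\<phi> (u - w)) = ?\<psi> u * ?\<psi> w"
    proof -
      have "- (u + w)\<^sup>2 / (4 * v) + - (u - w)\<^sup>2 / (4 * v) = - u\<^sup>2 / (2 * v) + - w\<^sup>2 / (2 * v)"
        using v by (simp add: field_simps power2_eq_square)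
      then have "exp (- (u + w)\<^sup>2 / (4 * v)) * exp (- (u - w)\<^sup>2 / (4 * v)) = exp (- u\<^sup>2 / (2 * v)) * exp (- w\<^sup>2 / (2 * v))"
        by (simp only: flip: exp_add)
      moreover have "2 * (1 / sqrt (4 * pi * v) * (1 / sqrt (4 * pi * v))) = 1 / sqrt (2 * pi * v) * (1 / sqrt (2 * pi * v))"
        using v by simp
      moreover have "?\<phi> x = 1 / sqrt (4 * pi * v) * exp (- x\<^sup>2 / (4 * v))"
        "?\<psi> x = 1 / sqrt (2 * pi * v) * exp (- x\<^sup>2 / (2 * v))" for x
        using v by (simp_all add: normal_density_def algebra_simps)
      moreover have "2 * (p * a * (p * b)) = 2 * (p * p) * (a * b)" "q * a * (q * b) = q * q * (a * b)"
        for p q a b :: real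
        by (simp_all add: mult_ac)
      ultimately show ?thesis by (simp only:)
    qed
    then show ?thesis by (simp flip: ennreal_numeral ennreal_mult')
  qed
  show ?thesis
    unfolding distributed_def
  proof (intro conjI measure_eqI)
    fix A assume "A \<in> sets (distr M lborel (\<lambda>\<omega>. ((X \<omega> + Y \<omega>) / 2, (X \<omega> - Y \<omega>) / 2)))"
    then have [measurable]: "A \<in> sets (borel \<Otimes>\<^sub>M borel)"
      by (simp only: sets_distr sets_lborel borel_prod)
    have "emeasure (distr M lborel (\<lambda>\<omega>. ((X \<omega> + Y \<omega>) / 2, (X \<omega> - Y \<omega>) / 2))) A
        = (\<integral>\<^sup>+\<omega>. indicator A ((X \<omega> + Y \<omega>) / 2, (X \<omega> - Y \<omega>) / 2) \<partial>M)"
      by (subst nn_integral_indicator[symmetric], simp add: borel_prod[symmetric])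
        (subst nn_integral_distr, auto simp: borel_prod[symmetric])
    also have "\<dots> = (\<integral>\<^sup>+x. (case x of (x, y) \<Rightarrow> ennreal (?\<phi> x) * ennreal (?\<phi> y)) *
        (case x of (x, y) \<Rightarrow> indicator A ((x + y) / 2, (x - y) / 2)) \<partial>(lborel \<Otimes>\<^sub>M lborel))"
      by (subst distributed_nn_integral[OF joint]) (auto simp: borel_prod)
    also have "\<dots> = (\<integral>\<^sup>+x. \<integral>\<^sup>+y. ennreal (?\<phi> x * ?\<phi> y) * indicator A ((x + y) / 2, (x - y) / 2) \<partial>lborel \<partial>lborel)"
      by (subst lborel.nn_integral_fst[symmetric]) (auto simp: ennreal_mult')
    \<comment> \<open>The planar change of variables is split into one-dimensional ones:
      \<open>y = 2 * u - x\<close> for fixed \<open>x\<close>, then, after exchanging the integrals,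
      \<open>x = u + w\<close> for fixed \<open>u\<close>.\<close>
    also have "\<dots> = (\<integral>\<^sup>+x. \<integral>\<^sup>+u. 2 * (ennreal (?\<phi> x * ?\<phi> (2 * u - x)) * indicator A (u, x - u)) \<partial>lborel \<partial>lborel)"
    proof (rule nn_integral_cong)
      fix x :: real
      show "(\<integral>\<^sup>+y. ennreal (?\<phi> x * ?\<phi> y) * indicator A ((x + y) / 2, (x - y) / 2) \<partial>lborel)
        = (\<integral>\<^sup>+u. 2 * (ennreal (?\<phi> x * ?\<phi> (2 * u - x)) * indicator A (u, x - u)) \<partial>lborel)"
        by (subst nn_integral_real_affine[where c = 2 and t = "- x"])
          (auto simp: nn_integral_cmult diff_divide_distrib algebra_simps)
    qed
    also have "\<dots> = (\<integral>\<^sup>+u. \<integral>\<^sup>+x. 2 * (ennreal (?\<phi> x * ?\<phi> (2 * u - x)) * indicator A (u, x - u)) \<partial>lborel \<partial>lborel)"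
      by (rule lborel_pair.Fubini') measurable
    also have "\<dots> = (\<integral>\<^sup>+u. \<integral>\<^sup>+w. ennreal (?\<psi> u * ?\<psi> w) * indicator A (u, w) \<partial>lborel \<partial>lborel)"
    proof (rule nn_integral_cong)
      fix u :: real
      show "(\<integral>\<^sup>+x. 2 * (ennreal (?\<phi> x * ?\<phi> (2 * u - x)) * indicator A (u, x - u)) \<partial>lborel)
        = (\<integral>\<^sup>+w. ennreal (?\<psi> u * ?\<psi> w) * indicator A (u, w) \<partial>lborel)"
      proof -
        have "2 * (ennreal (?\<phi> (u + w) * ?\<phi> (2 * u - (u + w))) * indicator A (u, u + w - u))
            = ennreal (?\<psi> u * ?\<psi> w) * indicator A (u, w)" for w
        proof -
          have "2 * u - (u + w) = u - w" "u + w - u = w" by simp_all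
          then show ?thesis by (simp only: density_eq flip: mult.assoc)
        qed
        then show ?thesis
          by (subst nn_integral_real_affine[where c = 1 and t = u]) simp_all
      qed
    qed
    also have "\<dots> = (\<integral>\<^sup>+x. (case x of (x, y) \<Rightarrow> ennreal (?\<psi> x * ?\<psi> y)) * indicator A x \<partial>(lborel \<Otimes>\<^sub>M lborel))"
      by (subst lborel.nn_integral_fst[symmetric]) auto
    also have "\<dots> = emeasure (density lborel (\<lambda>(x, y). ennreal (?\<psi> x * ?\<psi> y))) A"
      by (subst emeasure_density) (simp_all add: borel_prod[symmetric] lborel_prod)
    finally show "emeasure (distr M lborel (\<lambda>\<omega>. ((X \<omega> + Y \<omega>) / 2, (X \<omega> - Y \<omega>) / 2))) A
      = emeasure (density lborel (\<lambda>(x, y). ennreal (?\<psi> x * ?\<psi> y))) A" .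
  qed (auto simp: borel_prod[symmetric])
qed

end

subsection \<open>The limit of the refined walks\<close>

lemma geometric_increments:
  fixes a :: "nat \<Rightarrow> real"
  assumes step: "\<And>k. \<bar>a (Suc k) - a k\<bar> \<le> (3 / 4) ^ k * A + (1 / 2) ^ k * B"
  shows "convergent a" and "\<bar>lim a - a m\<bar> \<le> 4 * A * (3 / 4) ^ m + 2 * B * (1 / 2) ^ m"
proof -
  \<comment> \<open>The tail sums from \<open>m\<close> on of the two geometric series.\<close>
  let ?r = "\<lambda>m. 4 * A * (3 / 4) ^ m + 2 * B * (1 / 2) ^ m"
  have "\<bar>a (m + k) - a m\<bar> \<le> ?r m - ?r (m + k)" for m k
  proof (induction k)
    case (Suc k)
    have "\<bar>a (m + Suc k) - a m\<bar> \<le> \<bar>a (Suc (m + k)) - a (m + k)\<bar> + \<bar>a (m + k) - a m\<bar>" by simp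
    also have "\<dots> \<le> ((3 / 4) ^ (m + k) * A + (1 / 2) ^ (m + k) * B) + (?r m - ?r (m + k))"
      by (intro add_mono step Suc)
    also have "\<dots> = ?r m - ?r (m + Suc k)" by (simp add: field_simps)
    finally show ?case .
  qed simp
  note diff = this
  have r0: "?r \<longlonglongrightarrow> 0"
    by (auto intro!: tendsto_eq_intros LIMSEQ_realpow_zero)
  \<comment> \<open>\<open>A\<close> and \<open>B\<close> may have any sign, so nonnegativity is
    derived from \<open>?r\<close> being decreasing with limit 0.\<close>
  have nonneg: "0 \<le> ?r m" for m
  proof (rule tendsto_upperbound[OF _ _ trivial_limit_sequentially])
    show "(\<lambda>k. ?r (k + m)) \<longlonglongrightarrow> 0" using r0 by (rule LIMSEQ_ignore_initial_segment)
    have "?r (k + m) \<le> ?r m" for k using diff[of m k] by (simp add: add.commute abs_le_iff)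
    then show "eventually (\<lambda>k. ?r (k + m) \<le> ?r m) sequentially" by simp
  qed
  have le: "\<bar>a n - a m\<bar> \<le> ?r m" if "n \<ge> m" for n m
  proof -
    have "\<bar>a n - a m\<bar> \<le> ?r m - ?r n" using diff[of m "n - m"] that by simp
    then show ?thesis using nonneg[of n] by linarith
  qed
  have "Cauchy a"
  proof (rule metric_CauchyI)
    fix e :: real assume "e > 0"
    then have "eventually (\<lambda>m. ?r m < e / 2) sequentially"
      using r0 by (intro order_tendstoD) auto
    then obtain M where M: "?r M < e / 2" by (auto simp: eventually_sequentially)
    have "dist (a m) (a n) < e" if "m \<ge> M" "n \<ge> M" for m n
      using le[OF that(1)] le[OF that(2)] M unfolding dist_real_def by linarith
    then show "\<exists>M. \<forall>m\<ge>M. \<forall>n\<ge>M. dist (a m) (a n) < e" by blast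
  qed
  then show conv: "convergent a" by (simp add: Cauchy_convergent)
  show "\<bar>lim a - a m\<bar> \<le> ?r m"
  proof (rule tendsto_upperbound[OF _ _ trivial_limit_sequentially])
    show "(\<lambda>n. \<bar>a n - a m\<bar>) \<longlonglongrightarrow> \<bar>lim a - a m\<bar>"
      using conv by (intro tendsto_intros) (simp add: convergent_LIMSEQ_iff)
    show "eventually (\<lambda>n. \<bar>a n - a m\<bar> \<le> ?r m) sequentially"
      using eventually_ge_at_top[of m] by eventually_elim (rule le)
  qed
qed

lemma abs_walk_diff_le:
  assumes "\<And>k. x k \<in> {-1, 1 :: real}"
  shows "\<bar>walk x m - walk x n\<bar> \<le> \<bar>real m - real n\<bar>"
proof -
  have le: "\<bar>walk x b - walk x a\<bar> \<le> real b - real a" if "a \<le> b" for a b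
  proof -
    have "\<bar>walk x b - walk x a\<bar> \<le> (\<Sum>k\<in>{a..<b}. \<bar>x k\<bar>)"
      unfolding walk_diff[OF that] by (rule sum_abs)
    also have "\<dots> = (\<Sum>k\<in>{a..<b}. 1)"
    proof (rule sum.cong)
      show "\<bar>x k\<bar> = 1" for k using assms[of k] by auto
    qed simp
    finally show ?thesis using that by (simp add: of_nat_diff)
  qed
  show ?thesis
    using le[of m n] le[of n m] by (cases "m \<le> n") (auto simp: abs_minus_commute)
qed

lemma abs_nat_floor_diff_le:
  fixes x y :: real
  assumes "\<bar>x - y\<bar> \<le> 1"
  shows "\<bar>real (nat \<lfloor>x\<rfloor>) - real (nat \<lfloor>y\<rfloor>)\<bar> \<le> 1"
proof -
  have "\<lfloor>x\<rfloor> \<le> \<lfloor>y\<rfloor> + 1" "\<lfloor>y\<rfloor> \<le> \<lfloor>x\<rfloor> + 1"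
    using assms by linarith+
  then show ?thesis by linarith
qed

text \<open>Matches the clocks of two levels: halving the fine time once gives the number of
  completed pairs, halving it again the coarse time.\<close>

lemma nat_floor_quarter:
  fixes t :: real
  assumes "t \<ge> 0"
  shows "nat \<lfloor>4 ^ m * t\<rfloor> = nat \<lfloor>4 ^ Suc m * t\<rfloor> div 2 div 2"
proof -
  have "\<lfloor>4 ^ m * t\<rfloor> = \<lfloor>(4 ^ Suc m * t) / of_int 4\<rfloor>" by simp
  also have "\<dots> = \<lfloor>4 ^ Suc m * t\<rfloor> div 4" by (rule floor_divide_real_eq_div) simp
  finally show ?thesis by (simp add: nat_div_distrib' flip: div_mult2_eq)
qed

section \<open>Dyadic approximations built from coins\<close>

locale coin_tosses = prob_space +
  fixes X :: "bool \<times> nat \<times> nat \<Rightarrow> 'a \<Rightarrow> real"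
  assumes fair: "fair_signs UNIV X"
begin

definition level_steps :: "bool \<Rightarrow> nat \<Rightarrow> 'a \<Rightarrow> nat \<Rightarrow> real" where
  "level_steps c m \<omega> = steps (\<lambda>l k. X (c, l, k) \<omega>) m"

definition displacement :: "bool \<Rightarrow> nat \<Rightarrow> nat \<Rightarrow> 'a \<Rightarrow> real" where
  "displacement c m i \<omega> = walk (level_steps c m \<omega>) (moves (\<lambda>k. X (c, Suc m, k) \<omega>) i) - walk (level_steps c m \<omega>) (i div 2)"

text \<open>A step function in \<open>t\<close> rather than an interpolation, so that consecutive
  levels compare by integer division alone; its jumps have size \<open>(1 / 2) ^ m\<close> and
  vanish in the limit.\<close>

definition approx :: "nat \<Rightarrow> bool \<Rightarrow> real \<Rightarrow> 'a \<Rightarrow> real" where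
  "approx m c t \<omega> = (1 / 2) ^ m * walk (level_steps c m \<omega>) (nat \<lfloor>4 ^ m * t\<rfloor>)"

lemma fair_level:
  "fair_signs {(c, l, k). m \<le> l} (\<lambda>(c, l, k) \<omega>. if l = m then level_steps c m \<omega> k else X (c, l, k) \<omega>)"
  unfolding level_steps_def by (rule fair_signs_steps[OF fair])

lemma level_steps_values: "\<omega> \<in> space M \<Longrightarrow> level_steps c m \<omega> k \<in> {-1, 1}"
  using fair_signs_values[OF fair_level, of "(c, m, k)" m] by simp

lemma level_steps_measurable [measurable]: "(\<lambda>\<omega>. level_steps c m \<omega> k) \<in> borel_measurable M"
  using fair_signs_rv[OF fair_level, of "(c, m, k)" m] by simp

lemma approx_measurable [measurable]: "approx m c t \<in> borel_measurable M"
  unfolding approx_def walk_def by measurable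

lemma approx_0 [simp]: "approx m c 0 \<omega> = 0"
  by (simp add: approx_def walk_def)

lemma
  shows displacement_measurable [measurable]: "displacement c m i \<in> borel_measurable M"
    and displacement_tail: "t > 0 \<Longrightarrow> prob {\<omega> \<in> space M. y \<le> \<bar>displacement c m i \<omega>\<bar>}
      \<le> 4 * exp (t\<^sup>2 / 4 + t ^ 4 * i / 32 - t * y)"
proof -
  have pq: "inj (\<lambda>k::nat. (c, m, k))" "range (\<lambda>k. (c, m, k)) \<subseteq> {(c, l, k). m \<le> l}"
    "inj (\<lambda>k::nat. (c, Suc m, k))" "range (\<lambda>k. (c, Suc m, k)) \<subseteq> {(c, l, k). m \<le> l}"
    "range (\<lambda>k. (c, m, k)) \<inter> range (\<lambda>k. (c, Suc m, k)) = {}"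
    by (auto simp: inj_on_def)
  have eq: "displacement c m i = (\<lambda>\<omega>. walk (level_steps c m \<omega>) (moves (\<lambda>k. X (c, Suc m, k) \<omega>) i) - walk (level_steps c m \<omega>) (i div 2))"
    by (simp add: displacement_def fun_eq_iff)
  show "displacement c m i \<in> borel_measurable M"
    using displaced_walk_tail(1)[OF fair_level pq, of 1 i] by (simp add: eq)
  show "t > 0 \<Longrightarrow> prob {\<omega> \<in> space M. y \<le> \<bar>displacement c m i \<omega>\<bar>}
      \<le> 4 * exp (t\<^sup>2 / 4 + t ^ 4 * i / 32 - t * y)"
    using displaced_walk_tail(2)[OF fair_level pq, of t y i] by (simp add: eq)
qed

lemma approx_step:
  assumes w: "\<omega> \<in> space M" and t: "t \<ge> 0"
  shows "\<bar>approx (Suc m) c t \<omega> - approx m c t \<omega>\<bar>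
    \<le> (1 / 2) ^ m * (\<bar>displacement c m (nat \<lfloor>4 ^ Suc m * t\<rfloor> div 2) \<omega>\<bar> + 1 / 2)"
proof -
  define j where "j = nat \<lfloor>4 ^ Suc m * t\<rfloor>"
  define i where "i = j div 2"
  \<comment> \<open>At odd fine time one step is left unpaired. It has size at most 1 in fine units,
    hence 1/2 in coarse ones.\<close>
  define r where "r = walk (level_steps c (Suc m) \<omega>) j - walk (level_steps c (Suc m) \<omega>) (2 * i)"
  have r: "\<bar>r\<bar> \<le> 1"
  proof -
    have "\<bar>r\<bar> \<le> \<bar>real j - real (2 * i)\<bar>"
      unfolding r_def by (rule abs_walk_diff_le[OF level_steps_values[OF w]])
    also have "\<dots> \<le> 1" unfolding i_def by linarith
    finally show ?thesis .
  qed
  have "walk (level_steps c (Suc m) \<omega>) (2 * i) = 2 * walk (level_steps c m \<omega>) (moves (\<lambda>k. X (c, Suc m, k) \<omega>) i)"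
    by (simp add: level_steps_def walk_refine_even)
  then have fine: "walk (level_steps c (Suc m) \<omega>) j = 2 * walk (level_steps c m \<omega>) (moves (\<lambda>k. X (c, Suc m, k) \<omega>) i) + r"
    by (simp add: r_def)
  have "approx (Suc m) c t \<omega> - approx m c t \<omega> = (1 / 2) ^ m * (displacement c m i \<omega> + r / 2)"
  proof -
    have "(1 / 2) ^ Suc m * (2 * a + r) - (1 / 2) ^ m * b = (1 / 2) ^ m * ((a - b) + r / 2)" for a b
      by (simp add: algebra_simps)
    then show ?thesis
      unfolding approx_def nat_floor_quarter[OF t, of m] j_def[symmetric] fine displacement_def i_def[symmetric] .
  qed
  then have "\<bar>approx (Suc m) c t \<omega> - approx m c t \<omega>\<bar> = \<bar>(1 / 2) ^ m\<bar> * \<bar>displacement c m i \<omega> + r / 2\<bar>"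
    by (simp only: abs_mult)
  also have "\<bar>(1 / 2 :: real) ^ m\<bar> = (1 / 2) ^ m" by simp
  also have "(1 / 2) ^ m * \<bar>displacement c m i \<omega> + r / 2\<bar> \<le> (1 / 2) ^ m * (\<bar>displacement c m i \<omega>\<bar> + 1 / 2)"
    using r by (intro mult_left_mono) (linarith, simp)
  finally show ?thesis unfolding i_def j_def .
qed

text \<open>
  The thresholds leave room for both demands on them: \<open>2\<^bsup>-m\<^esup> (3/2)\<^bsup>m\<^esup> = (3/4)\<^bsup>m\<^esup>\<close> is summable, and
  \<open>(3/2)\<^bsup>m\<^esup>\<close> still beats the scale \<open>(4\<^bsup>m\<^esup> n)\<^bsup>1/4\<^esup>\<close> of the displacements geometrically.
\<close>

definition good :: "nat \<Rightarrow> real \<Rightarrow> 'a set" where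
  "good n z = {\<omega> \<in> space M. \<forall>c m. \<forall>i \<le> 2 * 4 ^ m * n. \<bar>displacement c m i \<omega>\<bar> < (3 / 2) ^ m * (z / 16)}"

lemma good_sets [measurable]: "good n z \<in> events"
  unfolding good_def by measurable

lemma good_approx_step:
  assumes w: "\<omega> \<in> good n z" and t: "0 \<le> t" "t \<le> real n"
  shows "\<bar>approx (Suc m) c t \<omega> - approx m c t \<omega>\<bar> \<le> (3 / 4) ^ m * (z / 16) + (1 / 2) ^ m * (1 / 2)"
proof -
  have "4 ^ Suc m * t \<le> real (4 ^ Suc m * n)" using t by simp
  then have "nat \<lfloor>4 ^ Suc m * t\<rfloor> \<le> 4 ^ Suc m * n" by linarith
  then have "nat \<lfloor>4 ^ Suc m * t\<rfloor> div 2 \<le> 2 * 4 ^ m * n" by simp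
  then have "\<bar>displacement c m (nat \<lfloor>4 ^ Suc m * t\<rfloor> div 2) \<omega>\<bar> \<le> (3 / 2) ^ m * (z / 16)"
    using w by (auto simp: good_def intro: less_imp_le)
  then have "(1 / 2) ^ m * (\<bar>displacement c m (nat \<lfloor>4 ^ Suc m * t\<rfloor> div 2) \<omega>\<bar> + 1 / 2)
      \<le> (1 / 2) ^ m * ((3 / 2) ^ m * (z / 16) + 1 / 2)"
    by (intro mult_left_mono) auto
  also have "\<dots> = (3 / 4) ^ m * (z / 16) + (1 / 2) ^ m * (1 / 2)"
    by (simp add: algebra_simps flip: power_mult_distrib)
  finally show ?thesis using approx_step[of \<omega> t m c] w t by (auto simp: good_def)
qed

text \<open>A union bound over the two components, all levels and all pair counts. The
  \<open>4 ^ m\<close> growth in the number of events is met by tails of order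
  \<open>(1 / 8) ^ m\<close>, leaving a convergent series.\<close>

lemma prob_good:
  assumes n: "n \<ge> 1" and g: "g \<ge> 960" and z: "z = real n powr (1 / 4) * g"
  shows "prob (space M - good n z) \<le> 96 * real n * exp (- g / 16)"
proof -
  define y where "y m = (3 / 2) ^ m * (z / 16)" for m :: nat
  define E where "E m = (\<Union>c. \<Union>i\<in>{..2 * 4 ^ m * n}. {\<omega> \<in> space M. y m \<le> \<bar>displacement c m i \<omega>\<bar>})" for m :: nat
  have D [measurable]: "{\<omega> \<in> space M. y m \<le> \<bar>displacement c m i \<omega>\<bar>} \<in> events" for c m i
    by measurable
  have [measurable]: "E m \<in> events" for m
    unfolding E_def by (intro sets.finite_UN D) auto
  have bound: "prob (E m) \<le> 48 * real n * exp (- g / 16) * (1 / 2) ^ m" for m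
  proof -
    \<comment> \<open>The largest order at which \<open>t ^ 4 * i\<close> stays bounded for all
      \<open>i \<le> 2 * 4 ^ m * n\<close>.\<close>
    define t where "t = (4 ^ m * real n) powr (- 1 / 4)"
    have pos: "1 \<le> 4 ^ m * real n" using n by (simp add: mult_ge1_I)
    then have t0: "t > 0" using n by (simp add: t_def)
    have t1: "t \<le> 1" unfolding t_def using powr_mono[of "- 1 / 4" 0, OF _ pos] pos n by simp
    have t4: "t ^ 4 = 1 / (4 ^ m * real n)"
    proof -
      have "t ^ 4 = t powr real 4" by (rule powr_realpow[OF t0, symmetric])
      also have "\<dots> = (4 ^ m * real n) powr (- 1 / 4 * real 4)"
        unfolding t_def by (rule powr_powr)
      finally show ?thesis using pos n by (simp add: powr_neg_one)
    qed
    have ty: "t * y m \<ge> g / 16 + real m * (g / 320)"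
    proof -
      have "t = (4 powr (1 / 4)) powr (- real m) * real n powr (- 1 / 4)"
        using n by (simp add: t_def powr_mult powr_powr flip: powr_realpow)
      then have "t * y m = (4 powr (1 / 4)) powr (- real m) * (3 / 2) ^ m * (g / 16) * (real n powr (- 1 / 4) * real n powr (1 / 4))"
        by (simp add: y_def z)
      also have "real n powr (- 1 / 4) * real n powr (1 / 4) = 1"
        using n by (simp flip: powr_add)
      also have "(4 powr (1 / 4)) powr (- real m) = 1 / sqrt 2 ^ m"
      proof -
        have "(4 :: real) powr (1 / 4) = ((2 powr 2) powr (1 / 4))" by simp
        also have "\<dots> = 2 powr (1 / 2)" by (subst powr_powr) simp
        also have "\<dots> = sqrt 2" by (simp add: powr_half_sqrt)
        finally show ?thesis by (simp add: powr_minus_divide powr_realpow)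
      qed
      finally have eq: "t * y m = (3 / 2 / sqrt 2) ^ m * (g / 16)"
        by (simp add: power_divide)
      \<comment> \<open>\<open>3 / 2\<close> outgrows \<open>4 powr (1 / 4) = sqrt 2\<close> by a
        factor of at least \<open>21 / 20\<close>; Bernoulli makes the gain linear in
        \<open>m\<close>, namely \<open>g / 320\<close> per level.\<close>
      have "sqrt 2 \<le> 10 / 7" by (rule real_le_lsqrt) (auto simp: power2_eq_square)
      then have "1 + 1 / 20 \<le> 3 / 2 / sqrt 2" by (simp add: field_simps)
      then have "(1 + 1 / 20) ^ m \<le> (3 / 2 / sqrt 2) ^ m" by (intro power_mono) auto
      moreover have "1 + real m * (1 / 20) \<le> (1 + 1 / 20) ^ m" by (rule Bernoulli_inequality) simp
      ultimately have "1 + real m / 20 \<le> (3 / 2 / sqrt 2) ^ m" by simp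
      then have "(1 + real m / 20) * (g / 16) \<le> t * y m"
        unfolding eq using g by (intro mult_right_mono) auto
      then show ?thesis by (simp add: algebra_simps)
    qed
    have single: "prob {\<omega> \<in> space M. y m \<le> \<bar>displacement c m i \<omega>\<bar>} \<le> 8 * exp (- g / 16) * (1 / 8) ^ m"
      if "i \<le> 2 * 4 ^ m * n" for c i
    proof -
      \<comment> \<open>The \<open>t\<close> terms add up to at most 5/16, and
        \<open>exp (1 / 2) \<le> 2\<close>. The requirement \<open>g \<ge> 960\<close> makes
        \<open>g / 320 \<ge> 3\<close>, and \<open>exp (- 3) \<le> 1 / 8\<close>.\<close>
      have "real i \<le> real (2 * 4 ^ m * n)" using that by (simp only: of_nat_le_iff)
      then have "t ^ 4 * i / 32 \<le> 1 / 16" unfolding t4 using pos by (simp add: field_simps)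
      moreover have "t\<^sup>2 / 4 \<le> 1 / 4" using t0 t1 by (simp add: power_le_one)
      moreover have "real m * 3 \<le> real m * (g / 320)" using g by (intro mult_left_mono) auto
      ultimately have "t\<^sup>2 / 4 + t ^ 4 * i / 32 - t * y m \<le> 1 / 2 + (- g / 16) + real m * (- 3)"
        using ty by linarith
      then have "exp (t\<^sup>2 / 4 + t ^ 4 * i / 32 - t * y m) \<le> exp (1 / 2 + (- g / 16) + real m * (- 3))"
        by simp
      also have "\<dots> = exp (1 / 2) * exp (- g / 16) * exp (- 3) ^ m"
        by (simp only: exp_add exp_of_nat_mult)
      also have "\<dots> \<le> 2 * exp (- g / 16) * (1 / 8) ^ m"
      proof (intro mult_mono power_mono)
        show "exp (1 / 2) \<le> (2 :: real)" using exp_bound_half[of "1 / 2 :: real"] by simp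
        have "(2 :: real) ^ 3 \<le> exp 1 ^ 3" using exp_ge_add_one_self[of "1 :: real"] by (intro power_mono) auto
        then have "8 \<le> exp (3 :: real)" by (simp flip: exp_of_nat_mult)
        then show "exp (- 3) \<le> (1 / 8 :: real)" by (simp add: exp_minus field_simps)
      qed auto
      finally show ?thesis using displacement_tail[OF t0, of "y m" c m i] by simp
    qed
    have "prob (E m) \<le> (\<Sum>c\<in>UNIV. prob (\<Union>i\<in>{..2 * 4 ^ m * n}. {\<omega> \<in> space M. y m \<le> \<bar>displacement c m i \<omega>\<bar>}))"
      unfolding E_def by (intro measure_UNION_le) auto
    also have "\<dots> \<le> (\<Sum>c\<in>(UNIV :: bool set). \<Sum>i\<in>{..2 * 4 ^ m * n}. prob {\<omega> \<in> space M. y m \<le> \<bar>displacement c m i \<omega>\<bar>})"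
      by (intro sum_mono measure_UNION_le) auto
    also have "\<dots> \<le> (\<Sum>c\<in>(UNIV :: bool set). \<Sum>i\<in>{..2 * 4 ^ m * n}. 8 * exp (- g / 16) * (1 / 8) ^ m)"
      by (intro sum_mono single) auto
    also have "\<dots> = 16 * exp (- g / 16) * (1 / 8) ^ m * (2 * 4 ^ m * real n + 1)"
      by (simp add: UNIV_bool algebra_simps)
    also have "\<dots> \<le> 16 * exp (- g / 16) * (1 / 8) ^ m * (3 * 4 ^ m * real n)"
      using pos by (intro mult_left_mono) (auto simp: mult.commute)
    also have "\<dots> = 48 * real n * exp (- g / 16) * ((1 / 8) ^ m * 4 ^ m)" by simp
    also have "(1 / 8) ^ m * 4 ^ m = (1 / 2 :: real) ^ m" by (simp flip: power_mult_distrib)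
    finally show ?thesis .
  qed
  have sums: "(\<lambda>m. 48 * real n * exp (- g / 16) * (1 / 2) ^ m) sums (48 * real n * exp (- g / 16) * 2)"
    using geometric_sums[of "1 / 2 :: real"] by (intro sums_mult) simp
  have summable: "summable (\<lambda>m. prob (E m))"
    by (rule summable_comparison_test'[OF sums_summable[OF sums], of 0]) (use bound in simp)
  have "space M - good n z \<subseteq> (\<Union>m. E m)"
  proof
    fix \<omega> assume w: "\<omega> \<in> space M - good n z"
    then obtain c m i where "i \<le> 2 * 4 ^ m * n" "\<not> \<bar>displacement c m i \<omega>\<bar> < y m"
      unfolding good_def y_def by blast
    then have "\<omega> \<in> E m" using w by (auto simp: E_def not_less)
    then show "\<omega> \<in> (\<Union>m. E m)" by blast
  qed
  then have "prob (space M - good n z) \<le> prob (\<Union>m. E m)"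
    by (intro finite_measure_mono) auto
  also have "\<dots> \<le> (\<Sum>m. prob (E m))"
    by (rule finite_measure_subadditive_countably) (use summable in auto)
  also have "\<dots> \<le> (\<Sum>m. 48 * real n * exp (- g / 16) * (1 / 2) ^ m)"
    by (rule suminf_le[OF bound summable sums_summable[OF sums]])
  also have "\<dots> = 96 * real n * exp (- g / 16)" using sums_unique[OF sums] by simp
  finally show ?thesis .
qed

section \<open>The limit process\<close>

definition convergence_set :: "'a set" where
  "convergence_set = {\<omega> \<in> space M. \<forall>n. \<exists>k. \<omega> \<in> good (Suc n) (real (Suc n) powr (1 / 4) * real k)}"

lemma convergence_set_sets [measurable]: "convergence_set \<in> events"
  unfolding convergence_set_def by measurable

lemma AE_convergence_set: "AE \<omega> in M. \<omega> \<in> convergence_set"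
proof -
  have "AE \<omega> in M. \<exists>k. \<omega> \<in> good (Suc n) (real (Suc n) powr (1 / 4) * real k)" for n
  proof -
    let ?G = "\<lambda>k. good (Suc n) (real (Suc n) powr (1 / 4) * real k)"
    let ?N = "\<Inter>k. space M - ?G k"
    have "prob ?N \<le> 0"
    proof (rule tendsto_lowerbound[OF _ _ trivial_limit_sequentially])
      show "(\<lambda>k. 96 * real (Suc n) * exp (- real k / 16)) \<longlonglongrightarrow> 0"
        by real_asymp
      show "eventually (\<lambda>k. prob ?N \<le> 96 * real (Suc n) * exp (- real k / 16)) sequentially"
        using eventually_ge_at_top[of 960]
      proof eventually_elim
        case (elim k)
        have "prob ?N \<le> prob (space M - ?G k)" by (intro finite_measure_mono) auto
        also have "\<dots> \<le> 96 * real (Suc n) * exp (- real k / 16)"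
          by (rule prob_good) (use elim in auto)
        finally show ?case .
      qed
    qed
    then have "prob ?N = 0" by (simp add: measure_le_0_iff)
    moreover have "?N \<in> events" by auto
    ultimately have "AE \<omega> in M. \<omega> \<notin> ?N" by (simp add: prob_eq_0)
    then show ?thesis using AE_space by eventually_elim auto
  qed
  then have "AE \<omega> in M. \<forall>n. \<exists>k. \<omega> \<in> good (Suc n) (real (Suc n) powr (1 / 4) * real k)"
    by (simp add: AE_all_countable)
  then show ?thesis using AE_space by eventually_elim (simp add: convergence_set_def)
qed

text \<open>The value 0 off the almost sure event makes the start at 0 and continuity hold at every
  sample point, as \<open>planar_brownian_motion\<close> demands.\<close>

definition motion :: "bool \<Rightarrow> real \<Rightarrow> 'a \<Rightarrow> real" where
  "motion c t \<omega> = (if \<omega> \<in> convergence_set then lim (\<lambda>m. approx m c t \<omega>) else 0)"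

lemma motion_approx:
  assumes "\<omega> \<in> good n z" "\<omega> \<in> convergence_set" and t: "0 \<le> t" "t \<le> real n"
  shows "\<bar>motion c t \<omega> - approx m c t \<omega>\<bar> \<le> z / 4 * (3 / 4) ^ m + (1 / 2) ^ m"
proof -
  have "\<bar>lim (\<lambda>m. approx m c t \<omega>) - approx m c t \<omega>\<bar>
      \<le> 4 * (z / 16) * (3 / 4) ^ m + 2 * (1 / 2) * (1 / 2) ^ m"
    by (rule geometric_increments(2)[OF good_approx_step[OF assms(1) t]])
  then show ?thesis using assms(2) by (simp add: motion_def)
qed

lemma convergence_set_good:
  assumes "\<omega> \<in> convergence_set"
  obtains n z where "t \<le> real n" "\<omega> \<in> good n z"
proof -
  have "\<omega> \<in> good (Suc (nat \<lceil>t\<rceil>)) (real (Suc (nat \<lceil>t\<rceil>)) powr (1 / 4) * real k) \<Longrightarrow> thesis" for k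
    by (rule that[rotated], assumption) linarith
  then show thesis using assms by (auto simp: convergence_set_def)
qed

lemma motion_LIMSEQ:
  assumes w: "\<omega> \<in> convergence_set" and t: "0 \<le> t"
  shows "(\<lambda>m. approx m c t \<omega>) \<longlonglongrightarrow> motion c t \<omega>"
proof -
  obtain n z where "t \<le> real n" "\<omega> \<in> good n z" using convergence_set_good[OF w] .
  then have "convergent (\<lambda>m. approx m c t \<omega>)"
    using t by (intro geometric_increments(1)[OF good_approx_step[of _ n z]])
  then show ?thesis using w by (simp add: motion_def convergent_LIMSEQ_iff)
qed

lemma motion_measurable [measurable]:
  assumes "0 \<le> t"
  shows "motion c t \<in> borel_measurable M"
proof (rule borel_measurable_LIMSEQ_real)
  show "(\<lambda>m. if \<omega> \<in> convergence_set then approx m c t \<omega> else 0) \<longlonglongrightarrow> motion c t \<omega>" for \<omega>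
    using motion_LIMSEQ[OF _ assms] by (cases "\<omega> \<in> convergence_set") (auto simp: motion_def)
qed measurable

lemma motion_0 [simp]: "motion c 0 \<omega> = 0"
  by (simp add: motion_def)

text \<open>Over times closer than \<open>(1 / 4) ^ m\<close> the step function
  \<open>approx m\<close> changes by at most one jump, and it is uniformly close to the limit up to
  a horizon \<open>n \<ge> s + 1\<close>, which contains all such times.\<close>

lemma motion_continuous:
  assumes "\<omega> \<in> space M"
  shows "continuous_on {0..} (\<lambda>t. motion c t \<omega>)"
proof (cases "\<omega> \<in> convergence_set")
  case False
  then show ?thesis by (simp add: motion_def)
next
  case w: True
  show ?thesis
    unfolding continuous_on_iff
  proof (intro ballI allI impI)
    fix s e :: real assume s: "s \<in> {0..}" and e: "0 < e"
    obtain n z where n: "s + 1 \<le> real n" "\<omega> \<in> good n z" using convergence_set_good[OF w] .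
    have "(\<lambda>m. 2 * (z / 4 * (3 / 4) ^ m + (1 / 2) ^ m) + (1 / 2) ^ m) \<longlonglongrightarrow> 0"
      by (auto intro!: tendsto_eq_intros LIMSEQ_realpow_zero)
    then have "eventually (\<lambda>m. 2 * (z / 4 * (3 / 4) ^ m + (1 / 2) ^ m) + (1 / 2) ^ m < e) sequentially"
      using e by (rule order_tendstoD)
    then obtain m where "2 * (z / 4 * (3 / 4) ^ m + (1 / 2) ^ m) + (1 / 2) ^ m < e"
      by (auto simp: eventually_sequentially)
    moreover define r where "r = z / 4 * (3 / 4) ^ m + (1 / 2) ^ m"
    ultimately have m: "2 * r + (1 / 2) ^ m < e" by simp
    show "\<exists>d>0. \<forall>t\<in>{0..}. dist t s < d \<longrightarrow> dist (motion c t \<omega>) (motion c s \<omega>) < e"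
    proof (intro exI[of _ "(1 / 4) ^ m"] conjI ballI impI)
      fix t :: real assume t: "t \<in> {0..}" and d: "dist t s < (1 / 4) ^ m"
      have "(1 / 4) ^ m \<le> (1 :: real)" by (simp add: power_le_one)
      then have tn: "t \<le> real n" using d n by (simp add: dist_real_def)
      have "\<bar>4 ^ m * t - 4 ^ m * s\<bar> = 4 ^ m * \<bar>t - s\<bar>"
        by (simp add: abs_mult flip: right_diff_distrib)
      also have "\<dots> \<le> 4 ^ m * (1 / 4) ^ m" using d by (intro mult_left_mono) (auto simp: dist_real_def)
      also have "\<dots> = 1" by (simp flip: power_mult_distrib)
      finally have "\<bar>real (nat \<lfloor>4 ^ m * t\<rfloor>) - real (nat \<lfloor>4 ^ m * s\<rfloor>)\<bar> \<le> 1"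
        by (rule abs_nat_floor_diff_le)
      then have "\<bar>walk (level_steps c m \<omega>) (nat \<lfloor>4 ^ m * t\<rfloor>) - walk (level_steps c m \<omega>) (nat \<lfloor>4 ^ m * s\<rfloor>)\<bar> \<le> 1"
        using abs_walk_diff_le[of "level_steps c m \<omega>" "nat \<lfloor>4 ^ m * t\<rfloor>" "nat \<lfloor>4 ^ m * s\<rfloor>", OF level_steps_values[OF assms]]
        by linarith
      then have "\<bar>approx m c t \<omega> - approx m c s \<omega>\<bar> \<le> (1 / 2) ^ m * 1"
        unfolding approx_def right_diff_distrib[symmetric] abs_mult by (intro mult_mono) auto
      moreover have "\<bar>motion c t \<omega> - approx m c t \<omega>\<bar> \<le> r" "\<bar>motion c s \<omega> - approx m c s \<omega>\<bar> \<le> r"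
        unfolding r_def by (rule motion_approx[OF n(2) w]; use s t tn n in simp)+
      ultimately show "dist (motion c t \<omega>) (motion c s \<omega>) < e"
        using m unfolding dist_real_def by linarith
    qed simp
  qed
qed

section \<open>Increments of the limit process\<close>

lemma approx_increment:
  assumes "0 \<le> s" "s \<le> t"
  shows "approx m c t \<omega> - approx m c s \<omega> =
    (1 / 2) ^ m * (\<Sum>i\<in>(\<lambda>k. (c, m, k)) ` {nat \<lfloor>4 ^ m * s\<rfloor>..<nat \<lfloor>4 ^ m * t\<rfloor>}.
      (\<lambda>(c, l, k) \<omega>. if l = m then level_steps c m \<omega> k else X (c, l, k) \<omega>) i \<omega>)"
proof -
  have "nat \<lfloor>4 ^ m * s\<rfloor> \<le> nat \<lfloor>4 ^ m * t\<rfloor>"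
    using assms by (intro nat_mono floor_mono) simp
  then show ?thesis
    by (simp add: approx_def walk_diff sum.reindex inj_on_def flip: right_diff_distrib)
qed

lemma motion_increment_LIMSEQ:
  assumes "0 \<le> s" "s \<le> t"
  shows "AE \<omega> in M. (\<lambda>m. approx m c t \<omega> - approx m c s \<omega>) \<longlonglongrightarrow> motion c t \<omega> - motion c s \<omega>"
  using AE_convergence_set by eventually_elim (use assms in \<open>auto intro!: tendsto_diff motion_LIMSEQ\<close>)

lemma motion_increment_normal:
  assumes "0 \<le> s" "s < t"
  shows "distributed M lborel (\<lambda>\<omega>. motion c t \<omega> - motion c s \<omega>) (normal_density 0 (sqrt (t - s)))"
proof (rule fair_signs_limit_normal[OF fair_level])
  let ?K = "\<lambda>m. (\<lambda>k. (c, m, k)) ` {nat \<lfloor>4 ^ m * s\<rfloor>..<nat \<lfloor>4 ^ m * t\<rfloor>}"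
  show "finite (?K m)" "?K m \<subseteq> {(c, l, k). m \<le> l}" for m by auto
  show "(\<lambda>m. (1 / 2) ^ m) \<longlonglongrightarrow> (0 :: real)" by (rule LIMSEQ_realpow_zero) auto
  show "(\<lambda>m. ((1 / 2) ^ m)\<^sup>2 * real (card (?K m))) \<longlonglongrightarrow> t - s"
  proof -
    have card: "real (card (?K m)) = real_of_int (\<lfloor>4 ^ m * t\<rfloor> - \<lfloor>4 ^ m * s\<rfloor>)" for m
    proof -
      have "0 \<le> \<lfloor>4 ^ m * s\<rfloor>" "0 \<le> \<lfloor>4 ^ m * t\<rfloor>" "\<lfloor>4 ^ m * s\<rfloor> \<le> \<lfloor>4 ^ m * t\<rfloor>"
        using assms by (auto intro!: floor_mono)
      then show ?thesis by (simp add: card_image inj_on_def of_nat_diff nat_mono)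
    qed
    have sq: "((1 / 2) ^ m)\<^sup>2 = (1 / 4 :: real) ^ m" for m
      by (simp add: power2_eq_square flip: power_mult_distrib)
    \<comment> \<open>The number of steps differs from \<open>4 ^ m * (t - s)\<close> by at most 1
      because of the two floors.\<close>
    have b: "\<bar>((1 / 2) ^ m)\<^sup>2 * real (card (?K m)) - (t - s)\<bar> \<le> (1 / 4) ^ m" for m
    proof -
      have "((1 / 2) ^ m)\<^sup>2 * real (card (?K m)) - (t - s)
          = (1 / 4) ^ m * (real (card (?K m)) - 4 ^ m * (t - s))"
        unfolding sq by (simp add: right_diff_distrib mult.assoc[symmetric] flip: power_mult_distrib)
      moreover have "\<bar>real (card (?K m)) - 4 ^ m * (t - s)\<bar> \<le> 1"
        unfolding card right_diff_distrib by linarith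
      ultimately show ?thesis by (simp add: abs_mult)
    qed
    have "(\<lambda>m. ((1 / 2) ^ m)\<^sup>2 * real (card (?K m)) - (t - s)) \<longlonglongrightarrow> 0"
      by (rule tendsto_0_le[of "\<lambda>m. (1 / 4) ^ m" _ _ 1]) (use b in \<open>auto intro!: LIMSEQ_realpow_zero\<close>)
    then show ?thesis by (simp add: LIM_zero_iff)
  qed
  show "AE \<omega> in M. (\<lambda>m. (1 / 2) ^ m * (\<Sum>i\<in>?K m.
      (\<lambda>(c, l, k) \<omega>. if l = m then level_steps c m \<omega> k else X (c, l, k) \<omega>) i \<omega>)) \<longlonglongrightarrow> motion c t \<omega> - motion c s \<omega>"
    using motion_increment_LIMSEQ[of s t c] assms approx_increment[of s t _ c] by simp
qed (use assms in auto)

text \<open>At each level, increments over successive intervals and in different components use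
  disjoint blocks of fair steps. Keeping both components in one family gives at once the
  independence of coordinates and of planar increments.\<close>

lemma motion_increments_indep:
  assumes \<tau>: "0 \<le> \<tau> 0" "\<And>i. i < n \<Longrightarrow> \<tau> i \<le> \<tau> (Suc i)"
  shows "indep_vars (\<lambda>_. borel) (\<lambda>(c, i) \<omega>. motion c (\<tau> (Suc i)) \<omega> - motion c (\<tau> i) \<omega>) (UNIV \<times> {..<n :: nat})"
proof -
  have mono: "\<tau> i \<le> \<tau> j" if "i \<le> j" "j \<le> n" for i j
    using that by (induction rule: dec_induct) (auto intro: order_trans[OF _ \<tau>(2)])
  have nonneg: "0 \<le> \<tau> i" if "i \<le> n" for i using mono[of 0 i] \<tau>(1) that by simp
  show ?thesis
  proof (rule indep_vars_limit[where Y = "\<lambda>m (c, i) \<omega>. approx m c (\<tau> (Suc i)) \<omega> - approx m c (\<tau> i) \<omega>"])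
    fix m
    define F where "F i = nat \<lfloor>4 ^ m * \<tau> i\<rfloor>" for i
    define K where "K = (\<lambda>(c, i). (\<lambda>k. (c :: bool, m, k)) ` {F i..<F (Suc i)})"
    define Z where "Z = (\<lambda>(c, l, k) \<omega>. if l = m then level_steps c m \<omega> k else X (c, l, k) \<omega>)"
    have F_mono: "F i \<le> F j" if "i \<le> j" "j \<le> n" for i j
      unfolding F_def using mono[OF that] by (intro nat_mono floor_mono) simp
    have "disjoint_family_on K (UNIV \<times> {..<n})"
      unfolding disjoint_family_on_def
    proof (intro ballI impI)
      fix p q :: "bool \<times> nat" assume "p \<in> UNIV \<times> {..<n}" "q \<in> UNIV \<times> {..<n}" "p \<noteq> q"
      then obtain c i c' j where pq: "p = (c, i)" "q = (c', j)" "i < n" "j < n" "(c, i) \<noteq> (c', j)"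
        by auto
      then consider "c \<noteq> c'" | "Suc i \<le> j" | "Suc j \<le> i" by fastforce
      then show "K p \<inter> K q = {}"
        using F_mono[of "Suc i" j] F_mono[of "Suc j" i] pq by cases (auto simp: K_def)
    qed
    then have "indep_vars (\<lambda>p. PiM (K p) (\<lambda>_. borel)) (\<lambda>p \<omega>. restrict (\<lambda>i. Z i \<omega>) (K p)) (UNIV \<times> {..<n})"
      using fair_level[of m]
      by (intro indep_vars_restrict[where I = "{(c, l, k). m \<le> l}"]) (auto simp: fair_signs_def Z_def K_def)
    then have "indep_vars (\<lambda>_. borel) (\<lambda>p \<omega>. (\<lambda>h. (1 / 2) ^ m * (\<Sum>i\<in>K p. h i)) (restrict (\<lambda>i. Z i \<omega>) (K p)))
        (UNIV \<times> {..<n})"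
      by (rule indep_vars_compose2) (auto intro!: borel_measurable_times borel_measurable_sum measurable_component_singleton)
    then show "indep_vars (\<lambda>_. borel) (\<lambda>(c, i) \<omega>. approx m c (\<tau> (Suc i)) \<omega> - approx m c (\<tau> i) \<omega>) (UNIV \<times> {..<n})"
    proof (rule indep_vars_cong[THEN iffD1, rotated -1])
      fix p :: "bool \<times> nat" assume "p \<in> UNIV \<times> {..<n}"
      then obtain c i where [simp]: "p = (c, i)" and "i < n" by auto
      then show "(\<lambda>\<omega>. (\<lambda>h. (1 / 2) ^ m * (\<Sum>i\<in>K p. h i)) (restrict (\<lambda>i. Z i \<omega>) (K p))) =
          (case p of (c, i) \<Rightarrow> \<lambda>\<omega>. approx m c (\<tau> (Suc i)) \<omega> - approx m c (\<tau> i) \<omega>)"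
        using approx_increment[OF nonneg \<tau>(2), of i m c] by (simp add: K_def F_def Z_def fun_eq_iff)
    qed auto
  qed (use nonneg \<tau>(2) motion_increment_LIMSEQ in auto)
qed

end

subsection \<open>The planar coupling\<close>

text \<open>The inverse of \<open>(x, y) \<mapsto> (x + y, x - y)\<close>: it takes the four pairs
  of signs to the four unit steps and divides norms by \<open>sqrt 2\<close>.\<close>

definition rotate_half :: "real \<Rightarrow> real \<Rightarrow> real \<times> real" where
  "rotate_half u v = ((u + v) / 2, (u - v) / 2)"

lemma rotate_half_diff: "rotate_half u v - rotate_half u' v' = rotate_half (u - u') (v - v')"
  by (simp add: rotate_half_def field_simps)

lemma measurable_rotate_half [measurable]:
  "f \<in> borel_measurable N \<Longrightarrow> g \<in> borel_measurable N \<Longrightarrow>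
    (\<lambda>\<omega>. rotate_half (f \<omega>) (g \<omega>)) \<in> borel_measurable N"
  unfolding rotate_half_def by (intro borel_measurable_Pair) auto

lemma norm_rotate_half_le:
  assumes "\<bar>u\<bar> \<le> r" "\<bar>v\<bar> \<le> r"
  shows "norm (rotate_half u v) \<le> r"
proof -
  have "u\<^sup>2 \<le> r\<^sup>2" "v\<^sup>2 \<le> r\<^sup>2" using assms by (auto intro!: power2_le_iff_abs_le[THEN iffD2])
  then have "((u + v) / 2)\<^sup>2 + ((u - v) / 2)\<^sup>2 \<le> r\<^sup>2"
    by (simp add: power2_eq_square field_simps)
  then have "sqrt (((u + v) / 2)\<^sup>2 + ((u - v) / 2)\<^sup>2) \<le> r"
    using assms by (intro real_le_lsqrt) auto
  then show ?thesis unfolding rotate_half_def norm_Pair real_norm_def power2_abs .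
qed

lemma linear_interpolation_rotate_half:
  "linear_interpolation (\<lambda>k. rotate_half (u k) (v k)) t =
    rotate_half (linear_interpolation u t) (linear_interpolation v t)"
  by (simp add: linear_interpolation_def rotate_half_def field_simps)

lemma linear_interpolation_walk_le:
  assumes "\<And>k. x k \<in> {-1, 1 :: real}"
  shows "\<bar>linear_interpolation (walk x) t - walk x (nat \<lfloor>t\<rfloor>)\<bar> \<le> 1"
proof -
  have "linear_interpolation (walk x) t - walk x (nat \<lfloor>t\<rfloor>) = (t - of_int \<lfloor>t\<rfloor>) * x (nat \<lfloor>t\<rfloor>)"
    by (simp add: linear_interpolation_def walk_Suc)
  moreover have "\<bar>x (nat \<lfloor>t\<rfloor>)\<bar> = 1" using assms[of "nat \<lfloor>t\<rfloor>"] by auto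
  moreover have "\<bar>t - of_int \<lfloor>t\<rfloor>\<bar> \<le> 1" by linarith
  ultimately show ?thesis by (simp add: abs_mult)
qed

section \<open>The coupled planar processes and their distance\<close>

context coin_tosses
begin

text \<open>Running the components at time \<open>2 * t\<close> compensates for the variance halved
  by \<open>rotate_half\<close>, and matches the clock \<open>2 * t\<close> of the walk.\<close>

definition planar_bm :: "real \<Rightarrow> 'a \<Rightarrow> real \<times> real" where
  "planar_bm t \<omega> = rotate_half (motion True (2 * t) \<omega>) (motion False (2 * t) \<omega>)"

definition planar_walk :: "nat \<Rightarrow> 'a \<Rightarrow> real \<times> real" where
  "planar_walk n \<omega> = rotate_half (walk (level_steps True 0 \<omega>) n) (walk (level_steps False 0 \<omega>) n)"

lemma planar_bm_increment_distributed:
  assumes le: "0 \<le> s" "s < t"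
  shows "distributed M lborel (\<lambda>\<omega>. planar_bm t \<omega> - planar_bm s \<omega>)
    (\<lambda>(x, y). ennreal (normal_density 0 (sqrt (t - s)) x * normal_density 0 (sqrt (t - s)) y))"
proof -
  \<comment> \<open>With a single interval, the joint family of increments reduces to the two
    components over \<open>[2 * s, 2 * t]\<close>.\<close>
  define \<tau> where "\<tau> i = (if i = 0 then 2 * s else 2 * t)" for i :: nat
  define D where "D c \<omega> = motion c (2 * t) \<omega> - motion c (2 * s) \<omega>" for c \<omega>
  let ?I = "UNIV \<times> {..<1 :: nat}"
  have "indep_vars (\<lambda>_. borel) (\<lambda>(c, i) \<omega>. motion c (\<tau> (Suc i)) \<omega> - motion c (\<tau> i) \<omega>) ?I"
    by (rule motion_increments_indep) (use le in \<open>auto simp: \<tau>_def\<close>)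
  from indep_var_restrict[OF this, of "{(True, 0)}" "{(False, 0)}"]
  have "indep_var borel ((\<lambda>h. h (True, 0)) \<circ> (\<lambda>\<omega>. restrict (\<lambda>p. (case p of (c, i) \<Rightarrow>
        \<lambda>\<omega>. motion c (\<tau> (Suc i)) \<omega> - motion c (\<tau> i) \<omega>) \<omega>) {(True, 0)}))
      borel ((\<lambda>h. h (False, 0)) \<circ> (\<lambda>\<omega>. restrict (\<lambda>p. (case p of (c, i) \<Rightarrow>
        \<lambda>\<omega>. motion c (\<tau> (Suc i)) \<omega> - motion c (\<tau> i) \<omega>) \<omega>) {(False, 0)}))"
    by (intro indep_var_compose) (auto intro!: measurable_component_singleton)
  then have indep: "indep_var borel (D True) borel (D False)"
    by (simp add: comp_def \<tau>_def D_def[abs_def])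
  have "distributed M lborel (D c) (normal_density 0 (sqrt (2 * (t - s))))" for c
    using motion_increment_normal[of "2 * s" "2 * t" c] le by (simp add: D_def[abs_def] right_diff_distrib)
  from distributed_normal_rotation[OF indep _ this this] le
  show ?thesis
    by (simp add: planar_bm_def rotate_half_diff D_def) (simp add: rotate_half_def)
qed

lemma planar_bm_increments_indep:
  assumes \<tau>: "0 \<le> \<tau> 0" "\<And>i. i < n \<Longrightarrow> \<tau> i \<le> \<tau> (Suc i)"
  shows "indep_vars (\<lambda>_. borel) (\<lambda>i \<omega>. planar_bm (\<tau> (Suc i)) \<omega> - planar_bm (\<tau> i) \<omega>) {..<n :: nat}"
proof -
  define D where "D = (\<lambda>(c, i) \<omega>. motion c (2 * \<tau> (Suc i)) \<omega> - motion c (2 * \<tau> i) \<omega>)"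
  let ?K = "\<lambda>i. (UNIV :: bool set) \<times> {i :: nat}"
  have "indep_vars (\<lambda>_. borel) D (UNIV \<times> {..<n})"
    unfolding D_def by (rule motion_increments_indep[of "\<lambda>i. 2 * \<tau> i"]) (use \<tau> in auto)
  then have "indep_vars (\<lambda>i. PiM (?K i) (\<lambda>_. borel)) (\<lambda>i \<omega>. restrict (\<lambda>p. D p \<omega>) (?K i)) {..<n}"
    by (rule indep_vars_restrict) (auto simp: disjoint_family_on_def)
  then have "indep_vars (\<lambda>_. borel) (\<lambda>i \<omega>. (\<lambda>h. rotate_half (h (True, i)) (h (False, i)))
      (restrict (\<lambda>p. D p \<omega>) (?K i))) {..<n}"
    by (rule indep_vars_compose2) (auto intro!: measurable_rotate_half measurable_component_singleton)
  then show ?thesis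
    by (simp add: planar_bm_def rotate_half_diff D_def)
qed

lemma planar_brownian_motion_planar_bm: "planar_brownian_motion planar_bm"
  unfolding planar_brownian_motion_def
proof (intro conjI allI ballI impI; (elim conjE)?)
  show "planar_bm t \<in> borel_measurable M" if "0 \<le> t" for t
    unfolding planar_bm_def using that by simp
  show "planar_bm 0 \<omega> = (0, 0)" for \<omega> by (simp add: planar_bm_def rotate_half_def)
  show "continuous_on {0..} (\<lambda>t. planar_bm t \<omega>)" if "\<omega> \<in> space M" for \<omega>
  proof -
    have "continuous_on {0..} (\<lambda>t. motion c (2 * t) \<omega>)" for c
      by (rule continuous_on_compose2[OF motion_continuous[OF that]]) (auto intro!: continuous_intros)
    then show ?thesis
      unfolding planar_bm_def rotate_half_def by (intro continuous_intros) auto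
  qed
qed (auto intro: planar_bm_increment_distributed planar_bm_increments_indep)

lemma planar_simple_random_walk_planar_walk: "planar_simple_random_walk planar_walk"
  unfolding planar_simple_random_walk_def
proof (intro exI[of _ "\<lambda>k \<omega>. rotate_half (X (True, 0, k - 1) \<omega>) (X (False, 0, k - 1) \<omega>)"] conjI allI ballI impI)
  \<comment> \<open>Coins are numbered from 0 and steps from 1; on \<open>{1..}\<close> the shift is
    injective, so the blocks are disjoint.\<close>
  let ?K = "\<lambda>k. {(True, 0, k - 1), (False, 0, k - 1)} :: (bool \<times> nat \<times> nat) set"
  have "indep_vars (\<lambda>k. PiM (?K k) (\<lambda>_. borel)) (\<lambda>k \<omega>. restrict (\<lambda>p. X p \<omega>) (?K k)) {1..}"
    using fair by (intro indep_vars_restrict[where I = UNIV]) (auto simp: fair_signs_def disjoint_family_on_def)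
  then have "indep_vars (\<lambda>_. borel) (\<lambda>k \<omega>. (\<lambda>h. rotate_half (h (True, 0, k - 1)) (h (False, 0, k - 1)))
      (restrict (\<lambda>p. X p \<omega>) (?K k))) {1..}"
    by (rule indep_vars_compose2) (auto intro!: measurable_rotate_half measurable_component_singleton)
  then show "indep_vars (\<lambda>_. borel) (\<lambda>k \<omega>. rotate_half (X (True, 0, k - 1) \<omega>) (X (False, 0, k - 1) \<omega>)) {1..}"
    by simp
  fix k :: nat and v :: "real \<times> real" assume v: "v \<in> {(1, 0), (-1, 0), (0, 1), (0, -1)}"
  \<comment> \<open>Each unit step corresponds to exactly one pattern of two coins, hence
    probability 1/4.\<close>
  define a where "a = (\<lambda>(c, l :: nat, k :: nat). if c then fst v + snd v else fst v - snd v)"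
  have "rotate_half x y = v \<longleftrightarrow> x = fst v + snd v \<and> y = fst v - snd v" for x y
    by (cases v) (auto simp: rotate_half_def field_simps)
  then have "{\<omega> \<in> space M. rotate_half (X (True, 0, k - 1) \<omega>) (X (False, 0, k - 1) \<omega>) = v} =
      {\<omega> \<in> space M. \<forall>p\<in>?K k. X p \<omega> = a p}"
    by (auto simp: a_def)
  also have "prob \<dots> = (1 / 2) ^ card (?K k)"
    by (rule fair_signs_pattern[OF fair]) (use v in \<open>auto simp: a_def\<close>)
  finally show "prob {\<omega> \<in> space M. rotate_half (X (True, 0, k - 1) \<omega>) (X (False, 0, k - 1) \<omega>) = v} = 1 / 4"
    by (simp add: power2_eq_square)
next
  fix n \<omega>
  have walk: "walk x n = (\<Sum>k=1..n. x (k - 1))" for x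
    unfolding walk_def by (rule sum.reindex_bij_witness[of _ "\<lambda>k. k - 1" Suc]) auto
  show "planar_walk n \<omega> = (\<Sum>k=1..n. rotate_half (X (True, 0, k - 1) \<omega>) (X (False, 0, k - 1) \<omega>))"
    by (simp add: planar_walk_def level_steps_def walk rotate_half_def sum_prod sum.distrib sum_subtractf
        flip: sum_divide_distrib)
qed

text \<open>Level 0 is within \<open>z / 4 + 1\<close> of the limit and interpolation adds at most
  1; \<open>z > 8 / 3\<close> says exactly that \<open>z / 4 + 2 < z\<close>. The horizon is
  \<open>2 * n\<close> because the components run at double speed.\<close>

lemma planar_approximation:
  assumes w: "\<omega> \<in> good (2 * n) z" "\<omega> \<in> convergence_set" and z: "z > 8 / 3"
  shows "(SUP t\<in>{0..real n}. norm (planar_bm t \<omega> - linear_interpolation (\<lambda>k. planar_walk k \<omega>) (2 * t))) < z"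
proof -
  have sp: "\<omega> \<in> space M" using w by (simp add: good_def)
  have "norm (planar_bm t \<omega> - linear_interpolation (\<lambda>k. planar_walk k \<omega>) (2 * t)) \<le> z / 4 + 2"
    if t: "t \<in> {0..real n}" for t
  proof -
    have "\<bar>motion c (2 * t) \<omega> - linear_interpolation (walk (level_steps c 0 \<omega>)) (2 * t)\<bar> \<le> z / 4 + 2" for c
    proof -
      have "\<bar>motion c (2 * t) \<omega> - walk (level_steps c 0 \<omega>) (nat \<lfloor>2 * t\<rfloor>)\<bar> \<le> z / 4 + 1"
        using motion_approx[OF w, of "2 * t" c 0] t by (simp add: approx_def)
      moreover have "\<bar>linear_interpolation (walk (level_steps c 0 \<omega>)) (2 * t) - walk (level_steps c 0 \<omega>) (nat \<lfloor>2 * t\<rfloor>)\<bar> \<le> 1"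
        by (rule linear_interpolation_walk_le[OF level_steps_values[OF sp]])
      ultimately show ?thesis by linarith
    qed
    then show ?thesis
      unfolding planar_bm_def planar_walk_def linear_interpolation_rotate_half rotate_half_diff
      by (intro norm_rotate_half_le)
  qed
  then have "(SUP t\<in>{0..real n}. norm (planar_bm t \<omega> - linear_interpolation (\<lambda>k. planar_walk k \<omega>) (2 * t))) \<le> z / 4 + 2"
    by (intro cSUP_least) auto
  also have "\<dots> < z" using z by simp
  finally show ?thesis .
qed

text \<open>For \<open>g < 1920\<close> the summand \<open>exp 60\<close> makes the bound exceed \<open>1\<close>.\<close>

lemma planar_approximation_prob:
  assumes n: "n \<ge> 1" and g: "g \<ge> 1"
  shows "prob {\<omega> \<in> space M. (SUP t\<in>{0..real n}.
        norm (planar_bm t \<omega> - linear_interpolation (\<lambda>k. planar_walk k \<omega>) (2 * t))) \<ge> real n powr (1 / 4) * g}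
    \<le> (192 + exp 60) * real n * exp (- (1 / 32) * g)"
    (is "prob ?A \<le> _")
proof (cases "g \<ge> 1920")
  case False
  have "prob ?A \<le> 1" by simp
  also have "1 \<le> exp (60 - g / 32)" using False by simp
  also have "\<dots> = exp 60 * exp (- (1 / 32) * g)" by (simp flip: exp_add)
  also have "\<dots> \<le> (192 + exp 60) * real n * exp (- (1 / 32) * g)"
  proof (rule mult_right_mono)
    have "exp 60 * 1 \<le> (192 + exp 60) * real n" using n by (intro mult_mono) auto
    then show "exp 60 \<le> (192 + exp 60) * real n" by simp
  qed simp
  finally show ?thesis .
next
  case True
  define z where "z = real n powr (1 / 4) * g"
  \<comment> \<open>Rewrites the threshold for horizon \<open>2 * n\<close>. The crude
    \<open>g' \<ge> g / 2\<close> turns 960 into 1920 and the rate 1/16 into 1/32, while the doubled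
    horizon turns 96 into 192.\<close>
  define g' where "g' = g / 2 powr (1 / 4)"
  have "(2 :: real) powr (1 / 4) \<le> 2 powr 1" by (intro powr_mono) auto
  then have g': "g / 2 \<le> g'" unfolding g'_def using g by (intro divide_left_mono) auto
  have z: "z = real (2 * n) powr (1 / 4) * g'" by (simp add: z_def g'_def powr_mult)
  have "1 \<le> real n powr (1 / 4)" using n by (intro ge_one_powr_ge_zero) auto
  then have "1 * g \<le> z" unfolding z_def using g by (intro mult_right_mono) auto
  then have z_big: "z > 8 / 3" using True by linarith
  have "?A \<subseteq> (space M - good (2 * n) z) \<union> (space M - convergence_set)"
    using planar_approximation[OF _ _ z_big, of _ n] unfolding z_def[symmetric]
    by (auto simp: not_le[symmetric])
  then have "prob ?A \<le> prob ((space M - good (2 * n) z) \<union> (space M - convergence_set))"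
    by (intro finite_measure_mono) auto
  also have "\<dots> \<le> prob (space M - good (2 * n) z) + prob (space M - convergence_set)"
    by (intro measure_Un_le) auto
  also have "prob (space M - convergence_set) = 0"
    using AE_convergence_set by (subst prob_compl) (auto simp: prob_eq_1)
  also have "prob (space M - good (2 * n) z) \<le> 96 * real (2 * n) * exp (- g' / 16)"
    by (rule prob_good[OF _ _ z]) (use n g' True in auto)
  also have "\<dots> \<le> 96 * real (2 * n) * exp (- (1 / 32) * g)"
    using g' by (intro mult_left_mono) auto
  also have "\<dots> \<le> (192 + exp 60) * real n * exp (- (1 / 32) * g)"
    by (intro mult_right_mono) (auto simp: distrib_right)
  finally show ?thesis by simp
qed

end

section \<open>Existence of the coins\<close>

lemma ex_coin_tosses: "\<exists>(M :: (nat \<Rightarrow> real) measure) X. coin_tosses M X"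
proof -
  let ?P = "measure_pmf (pmf_of_set {-1, 1 :: real})"
  let ?M = "PiM (UNIV :: nat set) (\<lambda>_. ?P)"
  interpret product_prob_space "\<lambda>_. ?P" "UNIV :: nat set" ..
  \<comment> \<open>Points of the product space may have arbitrary real coordinates; sending every
    value other than 1 to -1 gives signs at every sample point, not just almost surely.\<close>
  define X :: "bool \<times> nat \<times> nat \<Rightarrow> (nat \<Rightarrow> real) \<Rightarrow> real"
    where "X i \<omega> = (if \<omega> (to_nat i) = 1 then 1 else -1)" for i \<omega>
  have ps: "prob_space ?M" by (rule prob_space_PiM) (rule prob_space_measure_pmf)
  have "P.fair_signs UNIV X"
  proof (rule P.fair_signsI)
    have "(\<lambda>\<omega>. \<omega> (to_nat i)) \<in> measurable ?M ?P" for i :: "bool \<times> nat \<times> nat"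
      by (rule measurable_component_singleton) simp
    then have "(\<lambda>\<omega>. (\<lambda>x. if x = 1 then 1 else -1) (\<omega> (to_nat i))) \<in> borel_measurable ?M" for i :: "bool \<times> nat \<times> nat"
      by (rule measurable_compose) simp
    then show "X i \<in> borel_measurable ?M" for i by (simp add: X_def[abs_def])
    show "X i \<omega> \<in> {-1, 1}" for i \<omega> by (simp add: X_def)
    fix J :: "(bool \<times> nat \<times> nat) set" assume J: "finite J"
    have "P.prob {\<omega> \<in> space ?M. \<forall>i\<in>J. X i \<omega> = a i} = (1 / 2) ^ card J" if a: "\<forall>i\<in>J. a i \<in> {-1, 1}" for a
    proof -
      define A :: "nat \<Rightarrow> real set" where "A j = {x. (if x = 1 then 1 else -1) = a (from_nat j)}" for j
      have "{\<omega> \<in> space ?M. \<forall>i\<in>J. X i \<omega> = a i} = {\<omega> \<in> space ?M. \<forall>j\<in>to_nat ` J. \<omega> j \<in> A j}"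
        by (simp add: X_def A_def)
      also have "emeasure ?M \<dots> = (\<Prod>j\<in>to_nat ` J. emeasure ?P (A j))"
        by (rule emeasure_PiM_Collect) (use J in auto)
      also have "\<dots> = (\<Prod>j\<in>to_nat ` J. ennreal (1 / 2))"
      proof (rule prod.cong)
        fix j assume "j \<in> to_nat ` J"
        then have "a (from_nat j) \<in> {-1, 1}" using a by auto
        moreover have "{-1, 1} \<inter> {x. (if x = 1 then 1 else -1) = s} = {s}" if "s \<in> {-1, 1}" for s :: real
          using that by auto
        ultimately have "{-1, 1} \<inter> A j = {a (from_nat j)}" unfolding A_def by blast
        then have "measure ?P (A j) = 1 / 2" by (subst measure_pmf_of_set) auto
        then show "emeasure ?P (A j) = ennreal (1 / 2)" by (simp only: measure_pmf.emeasure_eq_measure)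
      qed simp
      also have "\<dots> = ennreal ((1 / 2) ^ card J)"
        unfolding prod_constant card_image[OF inj_on_subset[OF inj_to_nat subset_UNIV]]
        by (rule ennreal_power) simp
      finally show ?thesis by (simp add: measure_def)
    qed
    then show "\<exists>J'. finite J' \<and> J \<subseteq> J' \<and> J' \<subseteq> UNIV \<and> (\<forall>a. (\<forall>i\<in>J'. a i \<in> {-1, 1}) \<longrightarrow>
        P.prob {\<omega> \<in> space ?M. \<forall>i\<in>J'. X i \<omega> = a i} = (1 / 2) ^ card J')"
      using J by blast
  qed
  then have "coin_tosses ?M X"
    using ps by (simp add: coin_tosses_def coin_tosses_axioms_def)
  then show ?thesis by blast
qed

theorem theorem5p2:
  "\<exists>(M :: (nat \<Rightarrow> real) measure) (B :: real \<Rightarrow> (nat \<Rightarrow> real) \<Rightarrow> real \<times> real)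
      (S :: nat \<Rightarrow> (nat \<Rightarrow> real) \<Rightarrow> real \<times> real).
     prob_space M \<and>
     prob_space.planar_brownian_motion M B \<and>
     prob_space.planar_simple_random_walk M S \<and>
     (\<forall>g :: nat \<Rightarrow> real.
        (\<forall>n\<ge>1. g n \<ge> 1) \<and> g \<in> O(\<lambda>n. real n powr (1 / 4)) \<longrightarrow>
        (\<exists>b K :: real. b > 0 \<and> K > 0 \<and>
           (\<forall>n\<ge>1.
              measure M {\<omega> \<in> space M.
                (SUP t\<in>{0..real n}. norm (B t \<omega> - linear_interpolation (\<lambda>k. S k \<omega>) (2 * t)))
                  \<ge> real n powr (1 / 4) * g n}
              \<le> K * real n * exp (- b * g n))))"
proof -
  obtain M :: "(nat \<Rightarrow> real) measure" and X where "coin_tosses M X"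
    using ex_coin_tosses by blast
  then interpret coin_tosses M X .
  show ?thesis
  proof (intro exI[of _ M] exI[of _ planar_bm] exI[of _ planar_walk] conjI allI impI; (elim conjE)?)
    show "prob_space M" by (rule prob_space_axioms)
    show "planar_brownian_motion planar_bm" by (rule planar_brownian_motion_planar_bm)
    show "planar_simple_random_walk planar_walk" by (rule planar_simple_random_walk_planar_walk)
    fix g :: "nat \<Rightarrow> real" assume g: "\<forall>n\<ge>1. g n \<ge> 1"
    show "\<exists>b K :: real. b > 0 \<and> K > 0 \<and> (\<forall>n\<ge>1. prob {\<omega> \<in> space M.
        (SUP t\<in>{0..real n}. norm (planar_bm t \<omega> - linear_interpolation (\<lambda>k. planar_walk k \<omega>) (2 * t)))
          \<ge> real n powr (1 / 4) * g n} \<le> K * real n * exp (- b * g n))"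
      using g planar_approximation_prob
      by (intro exI[of _ "1 / 32"] exI[of _ "192 + exp 60"]) (auto simp: add_pos_pos simp del: mult_minus_left)
  qed
qed

end
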